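(* Let $F\in\{\widehat{\mathcal T},\widehat{\mathcal T}_{\rm lin}\}$ with $\gamma$ in the admissible range for $F$, let $\beta\in(0,1)$, $K_0\in\mathbb N$, $\alpha>0$, and write $r_F(w):=\|w-F(w)\|_{\mathcal M}$. Let the restart points $\{w_{n,0}\}_{n\ge0}$ be generated by the restarted scheme $$w_{n,k+1}=\frac{1}{k+2}w_{n,0}+\frac{k+1}{k+2}\mathcal S_\gamma(w_{n,k})\quad(k\ge0),\qquad w_{n+1,0}:=w_{n,K_n},\qquad \mathcal S_\gamma:=(1+\gamma)F-\gamma I,$$ where epoch $0$ has length $K_0$ and, for $n\ge1$, epoch $n$ is stopped at the first index $k=K_n$ for which $r_F(w_{n,k})\le\beta\,r_F(w_{n,0})$. Assume that $\mathcal M\succ0$, that all iterates remain in a set $\mathcal K\subset\mathbb R^n\times\mathbb R^m$, and that $F$ satisfies the sharpness condition $\alpha\operatorname{dist}_{\mathcal M}(w,W^\star)\le r_F(w)$ for all $w\in\mathcal K$. Then: (i) Every epoch $n\ge1$ terminates after finitely many inner iterations. If $w_{n,0}\notin W^\star$ and $\alpha_n:=r_F(w_{n,0})/\operatorname{dist}_{\mathcal M}(w_{n,0},W^\star)$, then $\alpha_n\ge\alpha$ and $$K_n\le\left\lceil\frac{2}{\alpha_n\beta(1+\gamma)}\right\rceil\le\left\lceil\frac{2}{\alpha\beta(1+\gamma)}\right\rceil .$$ If $w_{n,0}\in W^\star$, then $r_F(w_{n,0})=0$ and the restart condition holds at $k=0$. (ii) $r_F(w_{n,0})\le\beta^{n-1}r_F(w_{1,0})$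 for all $n\ge1$. (iii) For all $n\ge1$, $$\operatorname{dist}_{\mathcal M}(w_{n,0},W^\star)\le\frac{2}{\alpha(1+\gamma)(K_0+1)}\,\beta^{n-1}\operatorname{dist}_{\mathcal M}(w_{0,0},W^\star).$$
   Context: Setting: $A\in\mathbb R^{m\times n}$, $b\in\mathbb R^m$, $\sigma\ge0$; $f:\mathbb R^n\to\mathbb R$ is convex and continuously differentiable with Lipschitz continuous gradient; $g:\mathbb R^n\to(-\infty,+\infty]$ is proper, closed and convex; $\Phi:=f+g$; $P\in\mathbb R^{n\times n}$, $Q\in\mathbb R^{m\times m}$ are self-adjoint positive semidefinite. Define $$\mathcal M=\begin{pmatrix} P & A^\top \\ A & Q \end{pmatrix},\qquad \mathcal T(x,y)=\begin{pmatrix} \nabla f(x)+\partial g(x)-A^\top y+\sigma A^\top(Ax-b) \\ Ax-b \end{pmatrix},\qquad W^\star:=\mathcal T^{-1}(0),$$ and assume $W^\star\ne\emptyset$. Notation: $\|w\|_{\mathcal M}=\sqrt{\langle w,\mathcal Mw\rangle}$ and $\operatorname{dist}_{\mathcal M}(w,S)=\inf_{u\in S}\|w-u\|_{\mathcal M}$. Exact map: $\widehat{\mathcal T}:=(\mathcal M+\mathcal T)^{-1}\mathcal M$, considered under the assumptions $Q\succ0$, $\mathcal M\succeq0$, and that $\partial\Phi+P+\sigma A^\top A$ has a single-valued globally Lipschitz inverse on $\mathbb R^n$. Admissible range: $\gamma\in(-1,1]$. Linearized map: $h:\mathbb R^n\to\mathbb R$ is convex and continuously differentiable with $L_h$-Lipschitz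 gradient, $f-h+\frac\sigma2\|A\cdot-b\|^2$ is convex, $Q\succ0$, $P-A^\top Q^{-1}A\succ0$, and $\mu_x:=\lambda_{\min}(P-A^\top Q^{-1}A)>L_h/2$; with $\mathcal B_h(x,y)=(\nabla h(x),0)$ and $\mathcal A_h:=\mathcal T-\mathcal B_h$, $\widehat{\mathcal T}_{\rm lin}(w):=(\mathcal M+\mathcal A_h)^{-1}(\mathcal Mw-\mathcal B_h(w))$. Admissible range: $\gamma\in(-1,1-L_h/(2\mu_x))$. In both cases the map is single-valued with full domain, its fixed-point set is $W^\star$, and $\mathcal S_\gamma$ is nonexpansive in $\|\cdot\|_{\mathcal M}$. *)

theory Defs
  imports "HOL-Analysis.Analysis"
begin

section \<open>Smooth and extended-valued convex functions\<close>

definition gradient :: "('a::real_inner \<Rightarrow> real) \<Rightarrow> 'a \<Rightarrow> 'a" where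
  "gradient f x = (THE D. GDERIV f x :> D)"

definition cont_differentiable :: "('a::real_inner \<Rightarrow> real) \<Rightarrow> bool" where
  "cont_differentiable f \<longleftrightarrow> (\<forall>x. f differentiable (at x)) \<and> continuous_on UNIV (gradient f)"

definition ereal_epigraph :: "('a \<Rightarrow> ereal) \<Rightarrow> ('a \<times> real) set" where
  "ereal_epigraph g = {(x, t). g x \<le> ereal t}"

definition proper_closed_convex :: "('a::real_normed_vector \<Rightarrow> ereal) \<Rightarrow> bool" where
  "proper_closed_convex g \<longleftrightarrow>
     (\<forall>x. g x \<noteq> -\<infinity>) \<and> (\<exists>x. g x \<noteq> \<infinity>) \<and>
     closed (ereal_epigraph g) \<and> convex (ereal_epigraph g)"

text \<open>For a proper function the set below is empty wherever the function takes the value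
  \<open>\<infinity>\<close>, so no separate domain condition is needed.\<close>

definition subdifferential :: "('a::real_inner \<Rightarrow> ereal) \<Rightarrow> 'a \<Rightarrow> 'a set" where
  "subdifferential g x = {v. \<forall>z. g x + ereal (v \<bullet> (z - x)) \<le> g z}"


section \<open>Positive operators and the induced metric\<close>

definition self_adjoint :: "('a::real_inner \<Rightarrow> 'a) \<Rightarrow> bool" where
  "self_adjoint M \<longleftrightarrow> linear M \<and> (\<forall>u v. M u \<bullet> v = u \<bullet> M v)"

definition pos_semidef :: "('a::real_inner \<Rightarrow> 'a) \<Rightarrow> bool" where
  "pos_semidef M \<longleftrightarrow> self_adjoint M \<and> (\<forall>u. 0 \<le> u \<bullet> M u)"

definition pos_def :: "('a::real_inner \<Rightarrow> 'a) \<Rightarrow> bool" where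
  "pos_def M \<longleftrightarrow> self_adjoint M \<and> (\<forall>u. u \<noteq> 0 \<longrightarrow> 0 < u \<bullet> M u)"

definition op_norm :: "('a::real_inner \<Rightarrow> 'a) \<Rightarrow> 'a \<Rightarrow> real" where
  "op_norm M w = sqrt (w \<bullet> M w)"

definition op_dist :: "('a::real_inner \<Rightarrow> 'a) \<Rightarrow> 'a \<Rightarrow> 'a set \<Rightarrow> real" where
  "op_dist M w S = (INF u\<in>S. op_norm M (w - u))"

text \<open>Only used for symmetric matrices, whose set of real eigenvalues is finite and nonempty.\<close>

definition lambda_min :: "real^'n^'n \<Rightarrow> real" where
  "lambda_min S = Min {c. \<exists>v. v \<noteq> 0 \<and> S *v v = c *\<^sub>R v}"


section \<open>Set-valued operators\<close>

definition op_inv :: "('a \<Rightarrow> 'b set) \<Rightarrow> 'b \<Rightarrow> 'a set" where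
  "op_inv S z = {u. z \<in> S u}"

definition map_plus :: "('a \<Rightarrow> 'b::ab_group_add) \<Rightarrow> ('a \<Rightarrow> 'b set) \<Rightarrow> 'a \<Rightarrow> 'b set" where
  "map_plus M S u = {M u + s |s. s \<in> S u}"

definition has_lipschitz_inverse :: "('a::metric_space \<Rightarrow> 'b::metric_space set) \<Rightarrow> bool" where
  "has_lipschitz_inverse S \<longleftrightarrow>
     (\<exists>R L. (\<forall>z. op_inv S z = {R z}) \<and> L-lipschitz_on UNIV R)"


section \<open>The primal-dual operators\<close>

definition block_op ::
  "real^'n^'n \<Rightarrow> real^'n^'m \<Rightarrow> real^'m^'m \<Rightarrow> (real^'n) \<times> (real^'m) \<Rightarrow> (real^'n) \<times> (real^'m)" where
  "block_op P A Q = (\<lambda>(x, y). (P *v x + transpose A *v y, A *v x + Q *v y))"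

definition kkt_op ::
  "(real^'n \<Rightarrow> real) \<Rightarrow> (real^'n \<Rightarrow> ereal) \<Rightarrow> real^'n^'m \<Rightarrow> real^'m \<Rightarrow> real
    \<Rightarrow> (real^'n) \<times> (real^'m) \<Rightarrow> ((real^'n) \<times> (real^'m)) set" where
  "kkt_op f g A b \<sigma> = (\<lambda>(x, y).
     {(gradient f x + v - transpose A *v y + \<sigma> *\<^sub>R (transpose A *v (A *v x - b)), A *v x - b) |v.
       v \<in> subdifferential g x})"

definition forward_op ::
  "(real^'n \<Rightarrow> real) \<Rightarrow> (real^'n) \<times> (real^'m) \<Rightarrow> (real^'n) \<times> (real^'m)" where
  "forward_op h = (\<lambda>(x, y). (gradient h x, 0))"

text \<open>The resolvents in the next two definitions are singletons under the respective assumptions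
  below; \<^const>\<open>the_elem\<close> extracts the value.\<close>

definition exact_map ::
  "('a::ab_group_add \<Rightarrow> 'a) \<Rightarrow> ('a \<Rightarrow> 'a set) \<Rightarrow> 'a \<Rightarrow> 'a" where
  "exact_map M T w = the_elem (op_inv (map_plus M T) (M w))"

definition linearized_map ::
  "('a::ab_group_add \<Rightarrow> 'a) \<Rightarrow> ('a \<Rightarrow> 'a set) \<Rightarrow> ('a \<Rightarrow> 'a) \<Rightarrow> 'a \<Rightarrow> 'a" where
  "linearized_map M T B w =
     the_elem (op_inv (map_plus M (map_plus (\<lambda>u. - B u) T)) (M w - B w))"

definition exact_assms ::
  "(real^'n \<Rightarrow> real) \<Rightarrow> (real^'n \<Rightarrow> ereal) \<Rightarrow> real^'n^'m \<Rightarrow> real \<Rightarrow> real^'n^'n \<Rightarrow> real^'m^'m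
    \<Rightarrow> bool" where
  "exact_assms f g A \<sigma> P Q \<longleftrightarrow>
     pos_def ((*v) Q) \<and> pos_semidef (block_op P A Q) \<and>
     has_lipschitz_inverse
       (map_plus (\<lambda>x. P *v x + \<sigma> *\<^sub>R (transpose A *v (A *v x)))
                 (subdifferential (\<lambda>x. ereal (f x) + g x)))"

definition schur_compl :: "real^'n^'n \<Rightarrow> real^'n^'m \<Rightarrow> real^'m^'m \<Rightarrow> real^'n^'n" where
  "schur_compl P A Q = P - transpose A ** matrix_inv Q ** A"

definition linearized_assms ::
  "(real^'n \<Rightarrow> real) \<Rightarrow> real^'n^'m \<Rightarrow> real^'m \<Rightarrow> real \<Rightarrow> real^'n^'n \<Rightarrow> real^'m^'m
    \<Rightarrow> (real^'n \<Rightarrow> real) \<Rightarrow> real \<Rightarrow> bool" where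
  "linearized_assms f A b \<sigma> P Q h L\<^sub>h \<longleftrightarrow>
     convex_on UNIV h \<and> cont_differentiable h \<and> L\<^sub>h-lipschitz_on UNIV (gradient h) \<and>
     convex_on UNIV (\<lambda>x. f x - h x + \<sigma> / 2 * (norm (A *v x - b))\<^sup>2) \<and>
     pos_def ((*v) Q) \<and> pos_def ((*v) (schur_compl P A Q)) \<and>
     lambda_min (schur_compl P A Q) > L\<^sub>h / 2"


section \<open>The restarted Halpern scheme\<close>

definition relaxed_map :: "real \<Rightarrow> ('a::real_vector \<Rightarrow> 'a) \<Rightarrow> 'a \<Rightarrow> 'a" where
  "relaxed_map \<gamma> F w = (1 + \<gamma>) *\<^sub>R F w - \<gamma> *\<^sub>R w"

definition restart_cond :: "('a \<Rightarrow> real) \<Rightarrow> real \<Rightarrow> (nat \<Rightarrow> 'a) \<Rightarrow> nat \<Rightarrow> bool" where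
  "restart_cond r \<beta> u k \<longleftrightarrow> r (u k) \<le> \<beta> * r (u 0)"

text \<open>The inner sequence \<open>w n\<close> is continued past the stopping index; only its entries up to index
  \<open>K n\<close> belong to the run of the scheme. Should the stopping test of an epoch never succeed, then
  \<open>K n\<close> is an unspecified number; that this does not happen is to be proved separately.\<close>

definition restarted_halpern ::
  "('a::real_vector \<Rightarrow> 'a) \<Rightarrow> ('a \<Rightarrow> real) \<Rightarrow> real \<Rightarrow> nat \<Rightarrow> (nat \<Rightarrow> nat \<Rightarrow> 'a) \<Rightarrow> (nat \<Rightarrow> nat) \<Rightarrow> bool" where
  "restarted_halpern S r \<beta> K\<^sub>0 w K \<longleftrightarrow>
     (\<forall>n k. w n (Suc k) =
        (1 / (real k + 2)) *\<^sub>R w n 0 + ((real k + 1) / (real k + 2)) *\<^sub>R S (w n k)) \<and>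
     (\<forall>n. w (Suc n) 0 = w n (K n)) \<and>
     K 0 = K\<^sub>0 \<and>
     (\<forall>n\<ge>1. K n = (LEAST k. restart_cond r \<beta> (w n) k))"

end

theory Submission
  imports Defs
begin

text \<open>Everything rests on the rate
  \<open>r\<^sub>F(w\<^sub>k) \<le> 2 dist(w\<^sub>0, W) / ((1 + \<gamma>) (k + 1))\<close> of one Halpern epoch. With
  \<open>R\<^sub>k = w\<^sub>k - S w\<^sub>k\<close>, nonexpansiveness of \<open>S = S\<^sub>\<gamma>\<close> makes the potential
  \<open>k (k + 1) / 2 \<parallel>R\<^sub>k\<parallel>\<^sup>2 + (k + 1) \<langle>R\<^sub>k, w\<^sub>k - w\<^sub>0\<rangle>\<close> nonincreasing; it starts at \<open>0\<close>, and combining its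
  sign with \<open>\<parallel>R\<^sub>k\<parallel>\<^sup>2 \<le> 2 \<langle>R\<^sub>k, w\<^sub>k - z\<rangle>\<close> for a fixed point \<open>z\<close> gives the rate. At
  \<open>k = 0\<close> the rate also shows that a point at distance \<open>0\<close> from \<open>W\<close> lies in \<open>W\<close>, so
  that \<open>\<alpha>\<^sub>n\<close> is a genuine quotient.

  The exact map is the linearized map for \<open>h = 0\<close>. In both cases the primal and dual parts of the
  resolvent inclusion decouple, because \<open>\<M>\<close> cancels the skew part of \<open>\<T>\<close>. For the linearized
  map the primal inclusion is the optimality condition of a strongly convex minimization problem.
  Writing \<open>d = w - w'\<close> and \<open>s = d - (F w - F w')\<close>, monotonicity yields
  \<open>\<langle>d - s, \<M> s\<rangle> \<ge> - (L\<^sub>h / 4) \<parallel>s\<^sub>x\<parallel>\<^sup>2 \<ge> - (L\<^sub>h / (4 \<mu>\<^sub>x)) \<parallel>s\<parallel>\<^sup>2\<close>, where the norm of \<open>s\<close> is that of \<open>\<M>\<close> and the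
  last step uses the Schur complement; this is exactly what makes
  \<open>S\<^sub>\<gamma>\<close>, which maps the difference \<open>d\<close> to \<open>d - (1 + \<gamma>) s\<close>, nonexpansive.\<close>

section \<open>The Halpern iteration\<close>

lemma self_adjoint_inner: "self_adjoint M \<Longrightarrow> u \<bullet> M v = v \<bullet> M u"
  by (metis self_adjoint_def inner_commute)

lemma self_adjoint_diff_square:
  assumes "self_adjoint M"
  shows "(u - v) \<bullet> M (u - v) = u \<bullet> M u - 2 * (v \<bullet> M u) + v \<bullet> M v"
  using assms self_adjoint_inner[OF assms, of u v]
  by (simp add: self_adjoint_def linear_diff inner_diff_left inner_diff_right)

lemma pos_def_imp_pos_semidef: "pos_def M \<Longrightarrow> pos_semidef M"
  by (metis inner_zero_left less_imp_le order_refl pos_def_def pos_semidef_def)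

lemma halpern_residual_bound:
  fixes M S :: "'a::real_inner \<Rightarrow> 'a"
  assumes M: "pos_semidef M"
    and nonexp: "\<And>u v. (S u - S v) \<bullet> M (S u - S v) \<le> (u - v) \<bullet> M (u - v)"
    and rec: "\<And>k. x (Suc k) =
        (1 / (real k + 2)) *\<^sub>R x 0 + ((real k + 1) / (real k + 2)) *\<^sub>R S (x k)"
    and fix_pt: "S z = z"
  shows "(real k + 1) * op_norm M (x k - S (x k)) \<le> 2 * op_norm M (x 0 - z)"
proof -
  have sa: "self_adjoint M" and lin: "linear M" and sym: "\<And>u v. u \<bullet> M v = v \<bullet> M u" and pos: "\<And>u. 0 \<le> u \<bullet> M u"
    using M self_adjoint_inner by (auto simp: pos_semidef_def self_adjoint_def)
  note M_lin = linear_add[OF lin] linear_diff[OF lin] linear_cmul[OF lin] linear_0[OF lin]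
  define R where "R j = x j - S (x j)" for j
  define V where "V j = real j * (real j + 1) / 2 * (R j \<bullet> M (R j))
      + (real j + 1) * (R j \<bullet> M (x j - x 0))" for j
  have V_decreasing: "V (Suc j) \<le> V j" for j
  proof -
    let ?z = "x (Suc j) - x 0" and ?y = "x j - x 0" and ?a = "R (Suc j)" and ?c = "R j"
    define q where "q = (real j + 1) / (real j + 2)"
    have q: "1 / (real j + 2) = 1 - q" "(real j + 2) * q = real j + 1"
      unfolding q_def by (auto simp: field_simps)
    have z: "?z = q *\<^sub>R (?y - ?c)"
      unfolding rec[of j] R_def q_def[symmetric] q by (simp add: algebra_simps)
    have "(S (x (Suc j)) - S (x j)) = ?z - ?y - (?a - ?c)"
      by (simp add: R_def)
    then have "(?z - ?y - (?a - ?c)) \<bullet> M (?z - ?y - (?a - ?c)) \<le> (?z - ?y) \<bullet> M (?z - ?y)"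
      using nonexp[of "x (Suc j)" "x j"] by (metis diff_diff_eq2 diff_add_cancel)
    then have *: "(?a - ?c) \<bullet> M (?a - ?c) \<le> 2 * ((?a - ?c) \<bullet> M (?z - ?y))"
      using self_adjoint_diff_square[OF sa, of "?z - ?y" "?a - ?c"] by linarith
    define y where "y = ?y"
    define aa ac cc ay cy where "aa = ?a \<bullet> M ?a" and "ac = ?a \<bullet> M ?c" and "cc = ?c \<bullet> M ?c"
      and "ay = ?a \<bullet> M y" and "cy = ?c \<bullet> M y"
    have main: "aa - 2 * ac + cc \<le> 2 * (q * (ay - ac) - ay - q * (cy - cc) + cy)"
      using * unfolding z y_def[symmetric] aa_def ac_def cc_def ay_def cy_def
      by (simp add: M_lin inner_diff_left inner_diff_right sym[of ?c ?a] algebra_simps)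
    have V1: "V (Suc j) = (real j + 1) * (real j + 2) / 2 * aa + ((real j + 2) * q) * (ay - ac)"
      unfolding V_def z y_def[symmetric] aa_def ac_def ay_def mult.assoc
      by (simp add: M_lin inner_diff_right add.commute mult.commute)
    have V0: "V j = real j * (real j + 1) / 2 * cc + (real j + 1) * cy"
      unfolding V_def y_def cc_def cy_def by simp
    \<comment> \<open>The weight matches the coefficient of \<open>aa\<close> in
      \<open>V (Suc j)\<close>. With it the mixed terms \<open>ac\<close> and \<open>ay\<close>
      cancel, and the \<open>cc\<close> and \<open>cy\<close> terms add up to
      \<open>V j\<close>.\<close>
    have "((real j + 1) * (real j + 2) / 2) * (aa - 2 * ac + cc)
        \<le> ((real j + 1) * (real j + 2) / 2) * (2 * (q * (ay - ac) - ay - q * (cy - cc) + cy))"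
      by (rule mult_left_mono[OF main]) auto
    also have "\<dots> = (real j + 1) * (((real j + 2) * q) * (ay - ac) - (real j + 2) * ay
        - ((real j + 2) * q) * (cy - cc) + (real j + 2) * cy)"
      by (simp add: field_simps)
    finally show ?thesis
      unfolding V1 V0 q(2) by (simp add: field_simps)
  qed
  have V_nonpos: "V k \<le> 0"
  proof (induction k)
    case 0
    then show ?case by (simp add: V_def M_lin)
  next
    case (Suc k)
    then show ?case using V_decreasing[of k] by linarith
  qed
  have "(S (x k) - S z) \<bullet> M (S (x k) - S z) \<le> (x k - z) \<bullet> M (x k - z)"
    by (rule nonexp)
  moreover have "S (x k) - S z = (x k - z) - R k"
    by (simp add: R_def fix_pt)
  ultimately have half: "R k \<bullet> M (R k) \<le> 2 * (R k \<bullet> M (x k - z))"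
    using self_adjoint_diff_square[OF sa, of "x k - z" "R k"] by simp
  \<comment> \<open>The potential bounds \<open>k |R|^2\<close> by \<open>2 <R, x 0 - x k>\<close>,
    and \<open>half\<close> bounds \<open>|R|^2\<close> by \<open>2 <R, x k - z>\<close>. In the sum
    \<open>x k\<close> drops out and the weight \<open>k + 1\<close> remains, whence
    \<open>c\<close>.\<close>
  define c where "c = (real k + 1) / 2"
  have "(real k + 1) * (real k * (R k \<bullet> M (R k)) + 2 * (R k \<bullet> M (x k - x 0))) \<le> 0"
    using V_nonpos unfolding V_def by (simp add: field_simps)
  then have "real k * (R k \<bullet> M (R k)) + 2 * (R k \<bullet> M (x k - x 0)) \<le> 0"
    by (simp add: mult_le_0_iff)
  then have cR: "c * (R k \<bullet> M (R k)) \<le> R k \<bullet> M (x 0 - z)"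
    using half unfolding c_def by (simp add: M_lin inner_diff_right field_simps)
  \<comment> \<open>Completing the square replaces the Cauchy--Schwarz inequality.\<close>
  have "0 \<le> (x 0 - z - c *\<^sub>R R k) \<bullet> M (x 0 - z - c *\<^sub>R R k)"
    by (rule pos)
  also have "\<dots> = (x 0 - z) \<bullet> M (x 0 - z) - 2 * (c * (R k \<bullet> M (x 0 - z))) + c * (c * (R k \<bullet> M (R k)))"
    unfolding self_adjoint_diff_square[OF sa, of "x 0 - z"] by (simp add: linear_cmul[OF lin])
  also have "\<dots> \<le> (x 0 - z) \<bullet> M (x 0 - z) - c * (c * (R k \<bullet> M (R k)))"
    using mult_left_mono[OF cR, of c] by (simp add: c_def)
  finally have "c\<^sup>2 * (R k \<bullet> M (R k)) \<le> (x 0 - z) \<bullet> M (x 0 - z)"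
    by (simp add: power2_eq_square mult.assoc)
  then have "sqrt (c\<^sup>2 * (R k \<bullet> M (R k))) \<le> op_norm M (x 0 - z)"
    unfolding op_norm_def by (rule real_sqrt_le_mono)
  then show ?thesis
    by (simp add: real_sqrt_mult c_def op_norm_def R_def)
qed

section \<open>Smooth convex functions\<close>

text \<open>\<open>gradient\<close> is a definite description. Existence of the vector is the Riesz
  representation in coordinates; its uniqueness is that of the derivative.\<close>

lemma GDERIV_gradient:
  fixes f :: "'a::euclidean_space \<Rightarrow> real"
  assumes "f differentiable (at x)"
  shows "GDERIV f x :> gradient f x"
proof -
  obtain f' where f': "(f has_derivative f') (at x)"
    using assms by (auto simp: differentiable_def)
  define D where "D = (\<Sum>i\<in>Basis. f' i *\<^sub>R i)"
  have "f' = (\<lambda>u. u \<bullet> D)"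
  proof
    fix u
    have "f' u = f' (\<Sum>i\<in>Basis. (u \<bullet> i) *\<^sub>R i)"
      by (simp add: euclidean_representation)
    also have "\<dots> = (\<Sum>i\<in>Basis. (u \<bullet> i) * f' i)"
      using has_derivative_linear[OF f'] by (simp add: linear_sum linear_cmul)
    finally show "f' u = u \<bullet> D"
      by (simp add: D_def inner_sum_right mult.commute)
  qed
  then have "GDERIV f x :> D"
    using f' by (simp add: gderiv_def)
  moreover have "D' = D" if "GDERIV f x :> D'" for D'
    using has_derivative_unique[OF that[unfolded gderiv_def] \<open>GDERIV f x :> D\<close>[unfolded gderiv_def]]
    by (metis inner_commute vector_eq_rdot)
  ultimately show ?thesis
    unfolding gradient_def by (metis theI)
qed

lemma gradient_zero: "gradient (\<lambda>_. 0) x = 0"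
  for x :: "'a::euclidean_space"
  using has_derivative_unique[OF GDERIV_gradient[of "\<lambda>_. 0" x, unfolded gderiv_def] has_derivative_const[of 0]]
  by (metis differentiable_const inner_eq_zero_iff)

lemma GDERIV_along_line:
  assumes "GDERIV f (x + t *\<^sub>R d) :> D"
  shows "((\<lambda>s. f (x + s *\<^sub>R d)) has_real_derivative d \<bullet> D) (at t)"
proof -
  have "((\<lambda>s. x + s *\<^sub>R d) has_derivative (\<lambda>s. s *\<^sub>R d)) (at t)"
    by (auto intro!: derivative_eq_intros)
  from has_derivative_compose[OF this assms[unfolded gderiv_def]]
  show ?thesis
    by (simp add: has_field_derivative_def mult_commute_abs)
qed

lemma GDERIV_quotient_tendsto:
  assumes "GDERIV f x :> D"
  shows "((\<lambda>s. (f (x + s *\<^sub>R d) - f x) / s) \<longlongrightarrow> d \<bullet> D) (at_right 0)"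
proof -
  have "((\<lambda>s. f (x + s *\<^sub>R d)) has_real_derivative d \<bullet> D) (at 0)"
    using GDERIV_along_line[of f x 0 d D] assms by simp
  then have "((\<lambda>s. f (x + s *\<^sub>R d)) has_real_derivative d \<bullet> D) (at_right 0)"
    by (rule has_field_derivative_at_within)
  then show ?thesis
    by (simp add: has_field_derivative_iff)
qed

lemma convex_on_gradient_ineq:
  assumes "convex_on UNIV f" and D: "GDERIV f x :> D"
  shows "f x + D \<bullet> (z - x) \<le> f z"
proof -
  have "\<forall>\<^sub>F s in at_right 0. (f (x + s *\<^sub>R (z - x)) - f x) / s \<le> f z - f x"
  proof -
    have "(f (x + s *\<^sub>R (z - x)) - f x) / s \<le> f z - f x" if "0 < s" "s < 1" for s
    proof -
      have "f ((1 - s) *\<^sub>R x + s *\<^sub>R z) \<le> (1 - s) * f x + s * f z"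
        using assms(1) that by (intro convex_onD) auto
      also have "(1 - s) *\<^sub>R x + s *\<^sub>R z = x + s *\<^sub>R (z - x)"
        by (simp add: algebra_simps)
      finally show ?thesis
        using that by (simp add: field_simps)
    qed
    then show ?thesis
      unfolding eventually_at_right_field by (intro exI[of _ 1]) auto
  qed
  then have "(z - x) \<bullet> D \<le> f z - f x"
    by (intro tendsto_upperbound[OF GDERIV_quotient_tendsto[OF D]]) auto
  then show ?thesis
    by (simp add: inner_commute)
qed

lemma convex_gradient_monotone:
  assumes "convex_on UNIV f" and D: "\<And>x. GDERIV f x :> D x"
  shows "0 \<le> (x - y) \<bullet> (D x - D y)"
  using convex_on_gradient_ineq[OF assms(1) D[of x], of y] convex_on_gradient_ineq[OF assms(1) D[of y], of x]
  by (simp add: inner_diff_left inner_diff_right inner_commute)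

lemma lipschitz_gradient_descent:
  assumes D: "\<And>x. GDERIV f x :> D x" and L: "L-lipschitz_on UNIV D"
  shows "f z \<le> f x + D x \<bullet> (z - x) + L / 2 * (norm (z - x))\<^sup>2"
proof -
  define d where "d = z - x"
  \<comment> \<open>\<open>p\<close> is \<open>f\<close> on the segment minus its quadratic upper
    model. The Lipschitz bound makes its derivative nonpositive on \<open>[0, 1]\<close>, and
    \<open>p 1 \<le> p 0\<close> is the claim.\<close>
  define p where "p t = f (x + t *\<^sub>R d) - t * (D x \<bullet> d) - L * t\<^sup>2 / 2 * (norm d)\<^sup>2" for t :: real
  have "p 1 \<le> p 0"
  proof (rule DERIV_nonpos_imp_nonincreasing[where f = p])
    fix t :: real assume t: "0 \<le> t" "t \<le> 1"
    have "(p has_real_derivative (d \<bullet> D (x + t *\<^sub>R d) - D x \<bullet> d - L * t * (norm d)\<^sup>2)) (at t)"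
      unfolding p_def
      by (auto intro!: derivative_eq_intros GDERIV_along_line[OF D] simp: power2_eq_square)
    moreover have "d \<bullet> (D (x + t *\<^sub>R d) - D x) \<le> L * t * (norm d)\<^sup>2"
    proof -
      have "d \<bullet> (D (x + t *\<^sub>R d) - D x) \<le> norm d * norm (D (x + t *\<^sub>R d) - D x)"
        by (rule norm_cauchy_schwarz)
      also have "norm d * norm (D (x + t *\<^sub>R d) - D x) \<le> norm d * (L * (t * norm d))"
        using lipschitz_onD[OF L, of "x + t *\<^sub>R d" x] t
        by (intro mult_left_mono) (auto simp: dist_norm)
      finally show ?thesis
        by (simp add: power2_eq_square mult_ac)
    qed
    ultimately show "\<exists>y. (p has_real_derivative y) (at t) \<and> y \<le> 0"
      by (force simp: inner_diff_right inner_commute)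
  qed simp
  then show ?thesis
    by (simp add: p_def d_def)
qed

text \<open>This plays the role of cocoercivity of the gradient (Baillon--Haddad). Comparing the lower and
  upper bounds of \<open>f\<close> at \<open>x - s/2\<close> and \<open>y + s/2\<close> gives it without proving cocoercivity.\<close>

lemma convex_lipschitz_gradient_shift:
  assumes cvx: "convex_on UNIV f" and D: "\<And>x. GDERIV f x :> D x" and L: "L-lipschitz_on UNIV D"
  shows "- (L / 4) * (norm s)\<^sup>2 \<le> (x - y - s) \<bullet> (D x - D y)"
proof -
  \<comment> \<open>Shifting each point by half of \<open>s\<close> gives two error terms
    \<open>L / 2 * (norm s / 2)^2\<close>, which add up to the constant \<open>L / 4\<close>;
    moreover \<open>z - z'\<close> is exactly \<open>x - y - s\<close>.\<close>
  define z z' where "z = x - (1/2) *\<^sub>R s" and "z' = y + (1/2) *\<^sub>R s"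
  have "f y + D y \<bullet> (z - y) \<le> f x + D x \<bullet> (z - x) + L / 2 * (norm (z - x))\<^sup>2"
    using convex_on_gradient_ineq[OF cvx D] lipschitz_gradient_descent[OF D L] order_trans by blast
  moreover have "f x + D x \<bullet> (z' - x) \<le> f y + D y \<bullet> (z' - y) + L / 2 * (norm (z' - y))\<^sup>2"
    using convex_on_gradient_ineq[OF cvx D] lipschitz_gradient_descent[OF D L] order_trans by blast
  moreover have "norm (z - x) = norm s / 2" "norm (z' - y) = norm s / 2"
    by (auto simp: z_def z'_def)
  moreover have "x - y - s = z - z'"
    by (simp add: z_def z'_def algebra_simps flip: scaleR_add_left)
  ultimately show ?thesis
    by (simp add: inner_diff_left inner_diff_right inner_commute power_divide)
qed

section \<open>Extremal eigenvalues\<close>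

text \<open>The Rayleigh quotient attains its minimum on the compact unit sphere, and first-order
  optimality makes the minimizer an eigenvector.\<close>

lemma self_adjoint_min_eigenvector:
  fixes S :: "'a::euclidean_space \<Rightarrow> 'a"
  assumes "self_adjoint S"
  obtains c v where "v \<noteq> 0" "S v = c *\<^sub>R v" "\<And>u. c * (norm u)\<^sup>2 \<le> u \<bullet> S u"
proof -
  have lin: "linear S"
    using assms by (simp add: self_adjoint_def)
  obtain e :: 'a where "e \<in> Basis"
    using nonempty_Basis by blast
  then have "sphere (0::'a) 1 \<noteq> {}"
    by (auto intro!: exI[of _ e])
  moreover have "continuous_on (sphere 0 1) (\<lambda>u. u \<bullet> S u)"
    by (intro continuous_intros linear_continuous_on) (simp add: lin linear_conv_bounded_linear[symmetric])
  ultimately obtain v where v: "norm v = 1" and min: "\<And>u. norm u = 1 \<Longrightarrow> v \<bullet> S v \<le> u \<bullet> S u"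
    using continuous_attains_inf[of "sphere (0::'a) 1" "\<lambda>u. u \<bullet> S u"] compact_sphere by auto
  define c where "c = v \<bullet> S v"
  have rayleigh: "c * (norm u)\<^sup>2 \<le> u \<bullet> S u" for u
  proof (cases "u = 0")
    case False
    then have "c \<le> sgn u \<bullet> S (sgn u)"
      unfolding c_def by (intro min) (simp add: norm_sgn)
    also have "\<dots> = (u \<bullet> S u) / (norm u)\<^sup>2"
      by (simp add: sgn_div_norm linear_cmul[OF lin] power2_eq_square field_simps)
    finally show ?thesis
      using False by (simp add: field_simps)
  qed (simp add: linear_0[OF lin])
  \<comment> \<open>The residual \<open>q\<close> is orthogonal to \<open>v\<close>. If it were
    nonzero, moving from \<open>v\<close> to \<open>v - t q\<close> would violate
    \<open>rayleigh\<close> for small positive \<open>t\<close>.\<close>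
  define q where "q = S v - c *\<^sub>R v"
  have "q = 0"
  proof (rule ccontr)
    assume "q \<noteq> 0"
    have vq: "v \<bullet> q = 0"
      using v by (simp add: q_def inner_diff_right c_def dot_square_norm)
    have "0 \<le> - 2 * t * (norm q)\<^sup>2 + t\<^sup>2 * (q \<bullet> S q - c * (norm q)\<^sup>2)" for t
    proof -
      have "c * (norm (v - t *\<^sub>R q))\<^sup>2 \<le> (v - t *\<^sub>R q) \<bullet> S (v - t *\<^sub>R q)"
        by (rule rayleigh)
      moreover have "(norm (v - t *\<^sub>R q))\<^sup>2 = 1 + t\<^sup>2 * (norm q)\<^sup>2"
        using v vq unfolding power2_norm_eq_inner
        by (simp add: inner_diff_left inner_diff_right inner_commute power2_eq_square norm_eq_1)
      moreover have "q \<bullet> S v = (norm q)\<^sup>2"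
      proof -
        have "S v = q + c *\<^sub>R v" by (simp add: q_def)
        then show ?thesis using vq by (simp add: inner_add_right inner_commute power2_norm_eq_inner)
      qed
      moreover have "v \<bullet> S q = q \<bullet> S v"
        using assms by (simp add: self_adjoint_def inner_commute)
      ultimately show ?thesis
        by (simp add: inner_diff_left inner_diff_right linear_diff[OF lin] linear_cmul[OF lin]
            c_def[symmetric] power2_eq_square algebra_simps)
    qed
    note * = this
    \<comment> \<open>With \<open>e\<close> a positive bound for the quadratic coefficient,
      \<open>t = a / e\<close> minimizes \<open>- 2 t a + t^2 e\<close>, whose value there is
      \<open>- a^2 / e < 0\<close>.\<close>
    define a where "a = (norm q)\<^sup>2"
    define e where "e = \<bar>q \<bullet> S q - c * (norm q)\<^sup>2\<bar> + 1"
    have "a > 0" "e > 0" "q \<bullet> S q - c * (norm q)\<^sup>2 \<le> e"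
      using \<open>q \<noteq> 0\<close> by (auto simp: a_def e_def)
    then have "(a / e)\<^sup>2 * (q \<bullet> S q - c * (norm q)\<^sup>2) \<le> (a / e)\<^sup>2 * e"
      by (intro mult_left_mono) auto
    then have "0 \<le> - 2 * (a / e) * a + (a / e)\<^sup>2 * e"
      using *[of "a / e"] unfolding a_def by linarith
    then show False
      using \<open>a > 0\<close> \<open>e > 0\<close> by (auto simp: power2_eq_square field_simps mult_le_0_iff)
  qed
  then have "S v = c *\<^sub>R v" "v \<noteq> 0"
    using v by (auto simp: q_def)
  with rayleigh show thesis
    using that by blast
qed

text \<open>\<open>Min\<close> in \<open>lambda_min\<close> is meaningful only on a finite set.
  Eigenvectors chosen for distinct eigenvalues are nonzero and orthogonal, hence
  independent.\<close>

lemma self_adjoint_finite_eigenvalues: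
  fixes S :: "'a::euclidean_space \<Rightarrow> 'a"
  assumes "self_adjoint S"
  shows "finite {c. \<exists>v. v \<noteq> 0 \<and> S v = c *\<^sub>R v}" (is "finite ?C")
proof -
  define e where "e c = (SOME v. v \<noteq> 0 \<and> S v = c *\<^sub>R v)" for c
  have e: "e c \<noteq> 0" "S (e c) = c *\<^sub>R e c" if "c \<in> ?C" for c
    using that someI_ex[of "\<lambda>v. v \<noteq> 0 \<and> S v = c *\<^sub>R v"] by (auto simp: e_def)
  have orth: "e c \<bullet> e d = 0" if "c \<in> ?C" "d \<in> ?C" "c \<noteq> d" for c d
  proof -
    have "S (e c) \<bullet> e d = e c \<bullet> S (e d)"
      using assms by (simp add: self_adjoint_def)
    then show ?thesis
      using e that by simp
  qed
  have "pairwise orthogonal (e ` ?C)"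
    unfolding pairwise_def orthogonal_def using orth by blast
  moreover have "0 \<notin> e ` ?C"
    using e(1) by (metis (no_types, lifting) imageE)
  ultimately have "finite (e ` ?C)"
    by (intro independent_imp_finite pairwise_orthogonal_independent)
  moreover have "inj_on e ?C"
    using orth e by (metis (no_types, lifting) inj_onI inner_eq_zero_iff)
  ultimately show ?thesis
    by (rule finite_imageD)
qed

text \<open>The minimum \<open>c\<close> of the Rayleigh quotient is itself an eigenvalue, so
  \<open>lambda_min S\<close> lies below it.\<close>

lemma lambda_min_le:
  fixes S :: "real^'n^'n"
  assumes "self_adjoint ((*v) S)"
  shows "lambda_min S * (norm u)\<^sup>2 \<le> u \<bullet> (S *v u)"
proof -
  obtain c v where c: "v \<noteq> 0" "S *v v = c *\<^sub>R v" "\<And>u. c * (norm u)\<^sup>2 \<le> u \<bullet> (S *v u)"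
    using self_adjoint_min_eigenvector[OF assms] by blast
  then have "lambda_min S \<le> c"
    unfolding lambda_min_def using self_adjoint_finite_eigenvalues[OF assms] by (intro Min_le) auto
  then have "lambda_min S * (norm u)\<^sup>2 \<le> c * (norm u)\<^sup>2"
    by (simp add: mult_right_mono)
  then show ?thesis
    using c(3) order_trans by blast
qed

lemma pos_def_coercive:
  fixes S :: "'a::euclidean_space \<Rightarrow> 'a"
  assumes "pos_def S"
  obtains c where "0 < c" "\<And>u. c * (norm u)\<^sup>2 \<le> u \<bullet> S u"
proof -
  have "self_adjoint S"
    using assms by (simp add: pos_def_def)
  from self_adjoint_min_eigenvector[OF this]
  obtain c v where c: "v \<noteq> 0" "S v = c *\<^sub>R v" "\<And>u. c * (norm u)\<^sup>2 \<le> u \<bullet> S u"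
    by blast
  then have "0 < v \<bullet> c *\<^sub>R v"
    using assms by (metis pos_def_def)
  then have "0 < c"
    using c(1) zero_less_mult_pos2[of c "v \<bullet> v"] by simp
  with c(3) show thesis
    using that by blast
qed

section \<open>Subdifferentials of proper closed convex functions\<close>

text \<open>This moves subgradients to real arithmetic on the epigraph. A subgradient at
  \<open>x\<close> forces \<open>g x\<close> to be finite, by comparison with a point where
  \<open>g\<close> is finite.\<close>

lemma proper_subdifferential_iff:
  assumes "proper_closed_convex g"
  shows "v \<in> subdifferential g x \<longleftrightarrow>
    (\<exists>a. g x = ereal a \<and> (\<forall>z t. (z, t) \<in> ereal_epigraph g \<longrightarrow> a + v \<bullet> (z - x) \<le> t))"
proof
  assume v: "v \<in> subdifferential g x"
  obtain z0 where "g z0 \<noteq> \<infinity>"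
    using assms by (auto simp: proper_closed_convex_def)
  moreover have "g x + ereal (v \<bullet> (z0 - x)) \<le> g z0"
    using v by (simp add: subdifferential_def)
  ultimately have "g x \<noteq> \<infinity>"
    by auto
  moreover have "g x \<noteq> -\<infinity>"
    using assms by (simp add: proper_closed_convex_def)
  ultimately obtain a where a: "g x = ereal a"
    by (cases "g x") auto
  have "a + v \<bullet> (z - x) \<le> t" if "g z \<le> ereal t" for z t
  proof -
    have "ereal (a + v \<bullet> (z - x)) \<le> g z"
      using v a by (auto simp: subdifferential_def)
    then show ?thesis
      using that order_trans ereal_less_eq(3) by blast
  qed
  with a show "\<exists>a. g x = ereal a \<and> (\<forall>z t. (z, t) \<in> ereal_epigraph g \<longrightarrow> a + v \<bullet> (z - x) \<le> t)"
    by (auto simp: ereal_epigraph_def)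
next
  assume "\<exists>a. g x = ereal a \<and> (\<forall>z t. (z, t) \<in> ereal_epigraph g \<longrightarrow> a + v \<bullet> (z - x) \<le> t)"
  then obtain a where a: "g x = ereal a" "\<And>z t. g z \<le> ereal t \<Longrightarrow> a + v \<bullet> (z - x) \<le> t"
    by (auto simp: ereal_epigraph_def)
  have "g x + ereal (v \<bullet> (z - x)) \<le> g z" for z
    using a assms by (cases "g z") (auto simp: proper_closed_convex_def)
  then show "v \<in> subdifferential g x"
    by (simp add: subdifferential_def)
qed

lemma subdifferential_monotone:
  assumes "proper_closed_convex g" "v \<in> subdifferential g x" "v' \<in> subdifferential g x'"
  shows "0 \<le> (x - x') \<bullet> (v - v')"
proof -
  obtain a a' where a: "g x = ereal a" "g x' = ereal a'"
    and "a + v \<bullet> (x' - x) \<le> a'" "a' + v' \<bullet> (x - x') \<le> a"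
    using assms unfolding proper_subdifferential_iff[OF assms(1)] by (fastforce simp: ereal_epigraph_def)
  then show ?thesis
    by (simp add: inner_diff_left inner_diff_right inner_commute)
qed

text \<open>The subdifferential sum rule, stated on an epigraph \<open>E\<close> so that no arithmetic on extended
  reals occurs.\<close>

lemma subgradient_of_smooth_plus_convex:
  assumes cvx: "convex E" and xa: "(x, a) \<in> E" and D: "GDERIV f x :> D"
    and sub: "\<And>z t. (z, t) \<in> E \<Longrightarrow> f x + a + v \<bullet> (z - x) \<le> f z + t"
    and zt: "(z, t) \<in> E"
  shows "a + (v - D) \<bullet> (z - x) \<le> t"
proof -
  have "\<forall>\<^sub>F s in at_right 0. v \<bullet> (z - x) - (t - a) \<le> (f (x + s *\<^sub>R (z - x)) - f x) / s"
  proof -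
    \<comment> \<open>The segment from \<open>(x, a)\<close> to \<open>(z, t)\<close> stays in
      \<open>E\<close>, so \<open>sub\<close> applies along it. Dividing by \<open>s\<close> and
      letting \<open>s\<close> tend to 0 leaves the directional derivative of
      \<open>f\<close>.\<close>
    have "v \<bullet> (z - x) - (t - a) \<le> (f (x + s *\<^sub>R (z - x)) - f x) / s" if "0 < s" "s < 1" for s
    proof -
      have "(1 - s) *\<^sub>R (x, a) + s *\<^sub>R (z, t) \<in> E"
        using that by (intro convexD[OF cvx xa zt]) auto
      moreover have "(1 - s) *\<^sub>R (x, a) + s *\<^sub>R (z, t) = (x + s *\<^sub>R (z - x), a + s * (t - a))"
        by (simp add: algebra_simps)
      ultimately have "f x + a + v \<bullet> (x + s *\<^sub>R (z - x) - x) \<le> f (x + s *\<^sub>R (z - x)) + (a + s * (t - a))"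
        using sub by metis
      then have "s * (v \<bullet> (z - x) - (t - a)) \<le> f (x + s *\<^sub>R (z - x)) - f x"
        by (simp add: algebra_simps)
      then show ?thesis
        using that by (simp add: pos_le_divide_eq mult.commute)
    qed
    then show ?thesis
      unfolding eventually_at_right_field by (intro exI[of _ 1]) auto
  qed
  then have "v \<bullet> (z - x) - (t - a) \<le> (z - x) \<bullet> D"
    by (intro tendsto_lowerbound[OF GDERIV_quotient_tendsto[OF D]]) auto
  then show ?thesis
    by (simp add: inner_diff_left inner_commute)
qed

text \<open>\<open>exact_assms\<close> speaks of the subdifferential of \<open>f + g\<close>,
  \<open>kkt_op\<close> of the gradient of \<open>f\<close> plus a subgradient of \<open>g\<close>;
  this translates between the two. One direction adds the gradient inequality, the other is the
  segment argument above.\<close>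

lemma subdifferential_smooth_plus_convex:
  fixes f :: "'a::euclidean_space \<Rightarrow> real"
  assumes g: "proper_closed_convex g" and f: "convex_on UNIV f" and D: "GDERIV f x :> D"
  shows "v \<in> subdifferential (\<lambda>x. ereal (f x) + g x) x \<longleftrightarrow> v - D \<in> subdifferential g x"
proof
  assume "v - D \<in> subdifferential g x"
  then have *: "g x + ereal ((v - D) \<bullet> (z - x)) \<le> g z" for z
    by (simp add: subdifferential_def)
  have "ereal (f x) + g x + ereal (v \<bullet> (z - x)) \<le> ereal (f z) + g z" for z
  proof -
    have "ereal (f x) + g x + ereal (v \<bullet> (z - x))
        = ereal (f x + D \<bullet> (z - x)) + (g x + ereal ((v - D) \<bullet> (z - x)))"
      by (cases "g x") (auto simp: inner_diff_left)
    also have "\<dots> \<le> ereal (f z) + g z"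
      using convex_on_gradient_ineq[OF f D] * by (intro add_mono) auto
    finally show ?thesis .
  qed
  then show "v \<in> subdifferential (\<lambda>x. ereal (f x) + g x) x"
    by (simp add: subdifferential_def)
next
  assume v: "v \<in> subdifferential (\<lambda>x. ereal (f x) + g x) x"
  obtain z0 where "g z0 \<noteq> \<infinity>"
    using g by (auto simp: proper_closed_convex_def)
  moreover have "ereal (f x) + g x + ereal (v \<bullet> (z0 - x)) \<le> ereal (f z0) + g z0"
    using v by (simp add: subdifferential_def)
  ultimately have "g x \<noteq> \<infinity>"
    by auto
  moreover have "g x \<noteq> -\<infinity>"
    using g by (simp add: proper_closed_convex_def)
  ultimately obtain a where a: "g x = ereal a"
    by (cases "g x") auto
  have sub: "f x + a + v \<bullet> (z - x) \<le> f z + t" if "(z, t) \<in> ereal_epigraph g" for z t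
  proof -
    have "ereal (f x) + g x + ereal (v \<bullet> (z - x)) \<le> ereal (f z) + g z"
      using v by (simp add: subdifferential_def)
    also have "\<dots> \<le> ereal (f z) + ereal t"
      using that by (intro add_left_mono) (simp add: ereal_epigraph_def)
    finally show ?thesis
      by (simp add: a)
  qed
  have "(x, a) \<in> ereal_epigraph g"
    by (simp add: ereal_epigraph_def a)
  then have "a + (v - D) \<bullet> (z - x) \<le> t" if "(z, t) \<in> ereal_epigraph g" for z t
    using g sub that
    by (intro subgradient_of_smooth_plus_convex[OF _ _ D, of "ereal_epigraph g"])
       (auto simp: proper_closed_convex_def)
  then show "v - D \<in> subdifferential g x"
    unfolding proper_subdifferential_iff[OF g] using a by blast
qed

section \<open>Existence of minimizers and solvability of the primal inclusion\<close>

text \<open>A point one unit below the graph is strictly separated from the closed convex epigraph;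
  the separating hyperplane is the graph of the minorant.\<close>

lemma proper_closed_convex_affine_minorant:
  fixes g :: "'a::euclidean_space \<Rightarrow> ereal"
  assumes g: "proper_closed_convex g"
  obtains u c where "\<And>z t. (z, t) \<in> ereal_epigraph g \<Longrightarrow> u \<bullet> z + c \<le> t"
proof -
  obtain x0 where "g x0 \<noteq> \<infinity>" "g x0 \<noteq> -\<infinity>"
    using g by (auto simp: proper_closed_convex_def)
  then obtain a where a: "g x0 = ereal a"
    by (cases "g x0") auto
  have "(x0, a - 1) \<notin> ereal_epigraph g" and in_epi: "(x0, a) \<in> ereal_epigraph g"
    by (auto simp: ereal_epigraph_def a)
  then have "\<exists>p b. p \<bullet> (x0, a - 1) < b \<and> (\<forall>q\<in>ereal_epigraph g. p \<bullet> q > b)"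
    using g by (intro separating_hyperplane_closed_point) (auto simp: proper_closed_convex_def)
  then obtain p b where pb: "p \<bullet> (x0, a - 1) < b" "\<And>q. q \<in> ereal_epigraph g \<Longrightarrow> p \<bullet> q > b"
    by blast
  obtain p1 p2 where p: "p = (p1, p2)"
    by (cases p)
  \<comment> \<open>The separated point and \<open>(x0, a)\<close> differ only in height, so the
    hyperplane is not vertical and can be solved for the height.\<close>
  have "0 < p2"
    using pb(1) pb(2)[OF in_epi] by (simp add: p inner_prod_def algebra_simps)
  have "(- p1 /\<^sub>R p2) \<bullet> z + b / p2 \<le> t" if "(z, t) \<in> ereal_epigraph g" for z t
  proof -
    have "b - p1 \<bullet> z \<le> p2 * t"
      using pb(2)[OF that] by (simp add: p inner_prod_def)
    then have "(b - p1 \<bullet> z) / p2 \<le> t"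
      using \<open>0 < p2\<close> by (simp add: pos_divide_le_eq mult.commute)
    then show ?thesis
      by (simp add: divide_inverse algebra_simps)
  qed
  then show thesis
    using that by blast
qed

text \<open>Minimizing over pairs in the epigraph replaces an extended-valued objective by a
  continuous one. The quadratic growth of \<psi> beats the affine minorant of \<open>g\<close>, so a
  sublevel set is compact.\<close>

lemma strongly_convex_minimizer:
  fixes g :: "'a::euclidean_space \<Rightarrow> ereal"
  assumes g: "proper_closed_convex g" and cont: "continuous_on UNIV \<psi>"
    and c: "0 < c" and growth: "\<And>x. c * (norm x)\<^sup>2 + u \<bullet> x + e \<le> \<psi> x"
  obtains x a where "(x, a) \<in> ereal_epigraph g"
    "\<And>z t. (z, t) \<in> ereal_epigraph g \<Longrightarrow> \<psi> x + a \<le> \<psi> z + t"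
proof -
  let ?E = "ereal_epigraph g"
  obtain u' c' where minorant: "\<And>z t. (z, t) \<in> ?E \<Longrightarrow> u' \<bullet> z + c' \<le> t"
    using proper_closed_convex_affine_minorant[OF g] by blast
  obtain x0 where "g x0 \<noteq> \<infinity>" "g x0 \<noteq> -\<infinity>"
    using g by (auto simp: proper_closed_convex_def)
  then obtain a0 where a0: "(x0, a0) \<in> ?E"
    by (cases "g x0") (auto simp: ereal_epigraph_def)
  define m where "m = \<psi> x0 + a0"
  define C where "C = ?E \<inter> {q. \<psi> (fst q) + snd q \<le> m}"
  have cont': "continuous_on UNIV (\<lambda>q::'a \<times> real. \<psi> (fst q) + snd q)"
    by (intro continuous_intros continuous_on_compose2[OF cont]) auto
  have "closed C"
    unfolding C_def using g
    by (intro closed_Int closed_Collect_le cont' continuous_intros) (simp add: proper_closed_convex_def)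
  moreover have "bounded C"
  proof -
    \<comment> \<open>Any norm above both 1 and \<open>B / c\<close> makes \<open>c |z|^2\<close>
      exceed the right-hand side of \<open>quad\<close>. The height \<open>t\<close> is then bounded
      below by the minorant and above by \<open>m - \<psi> z\<close>.\<close>
    define B where "B = norm (u + u') + \<bar>m - e - c'\<bar> + 1"
    have bnd: "norm z \<le> B / c + 1 \<and> \<bar>t\<bar> \<le> norm u' * (B / c + 1) + \<bar>c'\<bar> + \<bar>m\<bar> + norm u * (B / c + 1) + \<bar>e\<bar>"
      if "(z, t) \<in> C" for z t
    proof -
      have t: "u' \<bullet> z + c' \<le> t" and m: "\<psi> z + t \<le> m"
        using that minorant by (auto simp: C_def)
      have u: "- (norm v * norm z) \<le> v \<bullet> z" for v :: 'a
        using norm_cauchy_schwarz[of "- v" z] by simp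
      have "c * (norm z)\<^sup>2 + (u + u') \<bullet> z \<le> m - e - c'"
        using growth[of z] t m by (simp add: inner_add_left)
      then have quad: "c * (norm z)\<^sup>2 \<le> norm (u + u') * norm z + \<bar>m - e - c'\<bar>"
        using u[of "u + u'"] by linarith
      have z: "norm z \<le> B / c + 1"
      proof (rule ccontr)
        assume "\<not> norm z \<le> B / c + 1"
        moreover have "0 \<le> B / c"
          using c by (simp add: B_def)
        ultimately have big: "B / c < norm z" "1 < norm z"
          by auto
        then have "B * norm z \<le> c * norm z * norm z"
          using c by (intro mult_right_mono) (auto simp: field_simps)
        moreover have "norm (u + u') * norm z + \<bar>m - e - c'\<bar> < B * norm z"
        proof -
          have "\<bar>m - e - c'\<bar> * 1 \<le> \<bar>m - e - c'\<bar> * norm z"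
            using big by (intro mult_left_mono) auto
          then show ?thesis
            using big by (simp add: B_def algebra_simps)
        qed
        ultimately show False
          using quad by (simp add: power2_eq_square mult.assoc)
      qed
      have bounds: "norm u' * norm z \<le> norm u' * (B / c + 1)" "norm u * norm z \<le> norm u * (B / c + 1)"
        using z by (auto intro!: mult_left_mono)
      have "0 \<le> c * (norm z)\<^sup>2"
        using c by simp
      moreover have "0 \<le> norm u' * (B / c + 1)" "0 \<le> norm u * (B / c + 1)"
        using bounds by (meson mult_nonneg_nonneg norm_ge_zero order_trans)+
      ultimately have "\<bar>t\<bar> \<le> norm u' * (B / c + 1) + \<bar>c'\<bar> + \<bar>m\<bar> + norm u * (B / c + 1) + \<bar>e\<bar>"
        using u[of u] u[of u'] t m growth[of z] bounds by linarith
      with z show ?thesis by blast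
    qed
    let ?R = "norm u' * (B / c + 1) + \<bar>c'\<bar> + \<bar>m\<bar> + norm u * (B / c + 1) + \<bar>e\<bar>"
    have "C \<subseteq> cball 0 (B / c + 1) \<times> cball 0 ?R"
      using bnd by auto
    then show ?thesis
      by (rule bounded_subset[OF bounded_Times[OF bounded_cball bounded_cball]])
  qed
  ultimately have "compact C"
    by (simp add: compact_eq_bounded_closed)
  moreover have "(x0, a0) \<in> C"
    using a0 by (simp add: C_def m_def)
  ultimately obtain q where q: "q \<in> C" "\<And>q'. q' \<in> C \<Longrightarrow> \<psi> (fst q) + snd q \<le> \<psi> (fst q') + snd q'"
    using continuous_attains_inf[of C "\<lambda>q. \<psi> (fst q) + snd q"] continuous_on_subset[OF cont' subset_UNIV]
    by blast
  show thesis
  proof (rule that[of "fst q" "snd q"])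
    show "(fst q, snd q) \<in> ?E"
      using q(1) by (simp add: C_def)
    fix z t assume zt: "(z, t) \<in> ?E"
    show "\<psi> (fst q) + snd q \<le> \<psi> z + t"
    proof (cases "\<psi> z + t \<le> m")
      case True
      then show ?thesis using q(2)[of "(z, t)"] zt by (simp add: C_def)
    next
      case False
      then show ?thesis using q(1) by (simp add: C_def)
    qed
  qed
qed

lemma GDERIV_quadratic_form:
  fixes M :: "'a::euclidean_space \<Rightarrow> 'a"
  assumes "self_adjoint M"
  shows "GDERIV (\<lambda>x. (x \<bullet> M x) / 2) x :> M x"
proof -
  have "bounded_linear M"
    using assms by (simp add: self_adjoint_def linear_conv_bounded_linear)
  then have "(M has_derivative M) (at x)"
    by (rule bounded_linear_imp_has_derivative)
  then have "((\<lambda>x. (x \<bullet> M x) / 2) has_derivative (\<lambda>h. (x \<bullet> M h + h \<bullet> M x) / 2)) (at x)"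
    by (auto intro!: derivative_eq_intros)
  then show ?thesis
    using assms by (simp add: gderiv_def self_adjoint_def inner_commute)
qed

text \<open>Existence: a minimizer of \<open>f x + <x, M x> / 2 - <x, p> + g x\<close> satisfies the
  inclusion by Fermat's rule. Uniqueness: for two solutions, monotonicity leaves
  \<open><x - y, M (x - y)> \<le> 0\<close>.\<close>

lemma convex_smooth_subgradient_equation:
  fixes g :: "'a::euclidean_space \<Rightarrow> ereal"
  assumes g: "proper_closed_convex g" and f: "convex_on UNIV f" and D: "\<And>x. GDERIV f x :> D x"
    and M: "pos_def M"
  shows "\<exists>!x. p - M x - D x \<in> subdifferential g x"
proof (rule ex_ex1I)
  have sa: "self_adjoint M"
    using M by (simp add: pos_def_def)
  obtain c where c: "0 < c" "\<And>u. c * (norm u)\<^sup>2 \<le> u \<bullet> M u"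
    using pos_def_coercive[OF M] by blast
  define \<psi> where "\<psi> x = f x + (x \<bullet> M x) / 2 - x \<bullet> p" for x
  have D\<psi>: "GDERIV \<psi> x :> D x + M x - p" for x
  proof -
    have "GDERIV (\<lambda>x. x \<bullet> p) x :> p"
      unfolding gderiv_def by (auto intro!: derivative_eq_intros)
    then show ?thesis
      unfolding \<psi>_def by (intro GDERIV_diff GDERIV_add D GDERIV_quadratic_form[OF sa])
  qed
  have "continuous_on UNIV \<psi>"
    using D\<psi> unfolding gderiv_def by (metis continuous_at_imp_continuous_on has_derivative_continuous)
  moreover have "c / 2 * (norm x)\<^sup>2 + (D 0 - p) \<bullet> x + f 0 \<le> \<psi> x" for x
    using c(2)[of x] convex_on_gradient_ineq[OF f D, of 0 x]
    by (simp add: \<psi>_def inner_diff_left inner_diff_right inner_commute)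
  ultimately obtain x a where xa: "(x, a) \<in> ereal_epigraph g"
    and min: "\<And>z t. (z, t) \<in> ereal_epigraph g \<Longrightarrow> \<psi> x + a \<le> \<psi> z + t"
    using strongly_convex_minimizer[OF g, of \<psi> "c / 2" "D 0 - p" "f 0"] c(1) by auto
  have "a + (0 - (D x + M x - p)) \<bullet> (z - x) \<le> t" if "(z, t) \<in> ereal_epigraph g" for z t
    using g min that xa
    by (intro subgradient_of_smooth_plus_convex[OF _ _ D\<psi>, of "ereal_epigraph g"])
       (auto simp: proper_closed_convex_def)
  \<comment> \<open>A minimizing pair lies on the graph, since lowering \<open>a\<close> to the
    value of \<open>g\<close> at \<open>x\<close> cannot improve the objective.\<close>
  moreover have "g x = ereal a"
  proof (cases "g x")
    case (real a')
    then have "a' \<le> a" "a \<le> a'"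
      using xa min[of x a'] by (auto simp: ereal_epigraph_def)
    then show ?thesis using real by simp
  qed (use xa g in \<open>auto simp: ereal_epigraph_def proper_closed_convex_def\<close>)
  moreover have "0 - (D x + M x - p) = p - M x - D x"
    by simp
  ultimately have "p - M x - D x \<in> subdifferential g x"
    unfolding proper_subdifferential_iff[OF g] by metis
  then show "\<exists>x. p - M x - D x \<in> subdifferential g x" ..
next
  fix x y assume xy: "p - M x - D x \<in> subdifferential g x" "p - M y - D y \<in> subdifferential g y"
  have "linear M"
    using M by (simp add: pos_def_def self_adjoint_def)
  then have "(x - y) \<bullet> M (x - y) \<le> 0"
    using subdifferential_monotone[OF g xy] convex_gradient_monotone[OF f D, of x y]
    by (simp add: linear_diff inner_diff_right)
  then show "x = y"
    using M by (metis leD pos_def_def right_minus_eq)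
qed

section \<open>The primal-dual resolvent\<close>

lemma inner_transpose_mult: "x \<bullet> (transpose A *v y) = (A *v x) \<bullet> y"
  for A :: "real^'n^'m"
  by (simp add: dot_lmul_matrix inner_commute[of x] inner_commute[of y])

lemma GDERIV_least_squares:
  fixes A :: "real^'n^'m"
  shows "GDERIV (\<lambda>x. \<sigma> / 2 * (norm (A *v x - b))\<^sup>2) x :> \<sigma> *\<^sub>R (transpose A *v (A *v x - b))"
proof -
  have "((*v) A has_derivative (*v) A) (at x)"
    by (intro bounded_linear_imp_has_derivative matrix_vector_mul_bounded_linear)
  then have "((\<lambda>x. \<sigma> / 2 * ((A *v x - b) \<bullet> (A *v x - b))) has_derivative
      (\<lambda>h. \<sigma> / 2 * ((A *v x - b) \<bullet> (A *v h) + (A *v h) \<bullet> (A *v x - b)))) (at x)"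
    by (auto intro!: derivative_eq_intros)
  then show ?thesis
    unfolding gderiv_def power2_norm_eq_inner inner_scaleR_right inner_transpose_mult
    by (simp add: inner_commute field_simps)
qed

lemma pos_def_matrix_inj: "pos_def ((*v) Q) \<Longrightarrow> inj ((*v) Q)"
  for Q :: "real^'m^'m"
  unfolding linear_injective_0[OF matrix_vector_mul_linear] by (force simp: pos_def_def)

text \<open>Completing the square in \<open>y\<close>: the block form is minimal over
  \<open>y\<close> at minus the inverse of \<open>Q\<close> applied to \<open>A *v x\<close>, and
  its value there is the Schur complement form.\<close>

lemma schur_compl_le_block_op:
  fixes A :: "real^'n^'m"
  assumes Q: "pos_def ((*v) Q)"
  shows "x \<bullet> (schur_compl P A Q *v x) \<le> (x, y) \<bullet> block_op P A Q (x, y)"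
proof -
  have sa: "self_adjoint ((*v) Q)"
    using Q by (simp add: pos_def_def)
  have "invertible Q"
    using pos_def_matrix_inj[OF Q] invertible_left_inverse matrix_left_invertible_injective by blast
  then have inv: "Q ** matrix_inv Q = mat 1"
    unfolding matrix_inv_def invertible_def by (rule someI2_ex) blast
  define z where "z = matrix_inv Q *v (A *v x)"
  have Qz: "Q *v z = A *v x"
    by (metis inv matrix_vector_mul_assoc matrix_vector_mul_lid z_def)
  have schur: "x \<bullet> (schur_compl P A Q *v x) = x \<bullet> (P *v x) - (A *v x) \<bullet> z"
    unfolding schur_compl_def z_def
    by (simp add: matrix_vector_mult_diff_rdistrib inner_diff_right inner_transpose_mult
        del: transpose_matrix_vector flip: matrix_vector_mul_assoc)
  have "0 \<le> (y + z) \<bullet> (Q *v (y + z))"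
    using Q by (cases "y + z = 0") (auto simp: pos_def_def less_imp_le)
  also have "\<dots> = y \<bullet> (Q *v y) + 2 * (y \<bullet> (A *v x)) + z \<bullet> (A *v x)"
    using self_adjoint_inner[OF sa, of z y]
    by (simp add: matrix_vector_right_distrib inner_add_left inner_add_right Qz)
  finally show ?thesis
    unfolding schur block_op_def
    by (simp add: inner_prod_def inner_add_right inner_transpose_mult inner_commute
        del: transpose_matrix_vector)
qed

lemma mem_op_inv_map_plus_iff:
  "u \<in> op_inv (map_plus M (map_plus B T)) z \<longleftrightarrow> (\<exists>s\<in>T u. z = M u + (B u + s))"
  by (auto simp: op_inv_def map_plus_def)

text \<open>The terms \<open>transpose A *v y\<close> of \<open>block_op\<close> and
  \<open>kkt_op\<close> have opposite signs, so the primal condition is free of \<open>y\<close>. In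
  the dual component both operators contribute \<open>A *v x\<close>, hence the factor 2.\<close>

lemma mem_resolvent_iff:
  fixes A :: "real^'n^'m"
  shows "(x, y) \<in> op_inv (map_plus (block_op P A Q)
      (map_plus (\<lambda>u. - forward_op h u) (kkt_op f g A b \<sigma>))) (p, q) \<longleftrightarrow>
    p - P *v x - (gradient f x - gradient h x + \<sigma> *\<^sub>R (transpose A *v (A *v x - b)))
      \<in> subdifferential g x \<and>
    Q *v y = q + b - 2 *\<^sub>R (A *v x)" (is "?L \<longleftrightarrow> ?v \<in> _ \<and> _")
proof -
  have "?L \<longleftrightarrow> (\<exists>v\<in>subdifferential g x.
      p = P *v x + transpose A *v y + (- gradient h x + (gradient f x + v - transpose A *v y
        + \<sigma> *\<^sub>R (transpose A *v (A *v x - b)))) \<and>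
      q = A *v x + Q *v y + (A *v x - b))"
    unfolding mem_op_inv_map_plus_iff
    by (simp add: block_op_def forward_op_def kkt_op_def Setcompr_eq_image del: transpose_matrix_vector)
  also have "\<dots> \<longleftrightarrow> (\<exists>v\<in>subdifferential g x. v = ?v \<and> Q *v y = q + b - 2 *\<^sub>R (A *v x))"
    by (intro bex_cong refl) (auto simp: algebra_simps scaleR_2 simp del: transpose_matrix_vector)
  finally show ?thesis by blast
qed

text \<open>The system is triangular: the primal inclusion determines \<open>x\<close>, then
  invertibility of \<open>Q\<close> determines \<open>y\<close>.\<close>

lemma resolvent_single_valued:
  fixes A :: "real^'n^'m"
  assumes Q: "pos_def ((*v) Q)"
    and x: "\<exists>!x. p - P *v x - (gradient f x - gradient h x + \<sigma> *\<^sub>R (transpose A *v (A *v x - b)))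
      \<in> subdifferential g x"
  shows "\<exists>!u. u \<in> op_inv (map_plus (block_op P A Q)
      (map_plus (\<lambda>u. - forward_op h u) (kkt_op f g A b \<sigma>))) (p, q)"
proof -
  have inj: "inj ((*v) Q)"
    using Q by (rule pos_def_matrix_inj)
  then have surj: "surj ((*v) Q)"
    by (simp add: linear_injective_imp_surjective matrix_vector_mul_linear)
  obtain x0 where x0: "p - P *v x0 - (gradient f x0 - gradient h x0
      + \<sigma> *\<^sub>R (transpose A *v (A *v x0 - b))) \<in> subdifferential g x0"
    using x by blast
  obtain y0 where y0: "q + b - 2 *\<^sub>R (A *v x0) = Q *v y0"
    using surj by (meson surjD)
  show ?thesis
  proof (rule ex1I[of _ "(x0, y0)"])
    show "(x0, y0) \<in> op_inv (map_plus (block_op P A Q)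
        (map_plus (\<lambda>u. - forward_op h u) (kkt_op f g A b \<sigma>))) (p, q)"
      unfolding mem_resolvent_iff using x0 y0 by simp
  next
    fix u assume u: "u \<in> op_inv (map_plus (block_op P A Q)
        (map_plus (\<lambda>u. - forward_op h u) (kkt_op f g A b \<sigma>))) (p, q)"
    obtain x1 y1 where xy: "u = (x1, y1)" by (cases u)
    have "x1 = x0"
      using x x0 u unfolding xy mem_resolvent_iff by blast
    moreover have "y1 = y0"
      using u y0 inj unfolding xy mem_resolvent_iff \<open>x1 = x0\<close> by (metis injD)
    ultimately show "u = (x0, y0)" by (simp add: xy)
  qed
qed

lemma map_plus_zero: "map_plus (\<lambda>_. 0) T = T"
  by (auto simp: map_plus_def fun_eq_iff)

lemma exact_map_eq_linearized_map: "exact_map M T = linearized_map M T (forward_op (\<lambda>_. 0))"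
proof -
  have zero: "forward_op (\<lambda>_. 0) = (\<lambda>_. 0)"
    by (auto simp: forward_op_def gradient_zero fun_eq_iff zero_prod_def)
  show ?thesis
    unfolding zero by (rule ext) (simp add: exact_map_def linearized_map_def map_plus_zero)
qed

lemma linearized_map_mem:
  assumes "\<exists>!u. u \<in> op_inv (map_plus M (map_plus (\<lambda>u. - B u) T)) (M w - B w)"
  shows "linearized_map M T B w \<in> op_inv (map_plus M (map_plus (\<lambda>u. - B u) T)) (M w - B w)"
proof -
  obtain u where "op_inv (map_plus M (map_plus (\<lambda>u. - B u) T)) (M w - B w) = {u}"
    using assms by blast
  then show ?thesis
    by (simp add: linearized_map_def)
qed

text \<open>At \<open>u = w\<close> the terms \<open>M w\<close> and \<open>B w\<close> cancel in
  the resolvent inclusion, leaving \<open>0 \<in> T w\<close>.\<close>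

lemma linearized_map_fixed_iff:
  assumes single: "\<exists>!u. u \<in> op_inv (map_plus M (map_plus (\<lambda>u. - B u) T)) (M w - B w)"
  shows "linearized_map M T B w = w \<longleftrightarrow> w \<in> op_inv T 0"
proof -
  have "w \<in> op_inv T 0 \<longleftrightarrow> w \<in> op_inv (map_plus M (map_plus (\<lambda>u. - B u) T)) (M w - B w)"
    unfolding mem_op_inv_map_plus_iff by (force simp: op_inv_def)
  then show ?thesis
    using linearized_map_mem[OF single] single by metis
qed

lemma resolvent_step_bound:
  fixes A :: "real^'n^'m" and P Q f g h b \<sigma>
  defines "J \<equiv> op_inv (map_plus (block_op P A Q)
      (map_plus (\<lambda>u. - forward_op h u) (kkt_op f g A b \<sigma>)))"
  assumes g: "proper_closed_convex g"
    and f: "cont_differentiable f"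
    and h: "convex_on UNIV h" "cont_differentiable h" "L-lipschitz_on UNIV (gradient h)"
    and fh: "convex_on UNIV (\<lambda>x. f x - h x + \<sigma> / 2 * (norm (A *v x - b))\<^sup>2)"
    and u: "u \<in> J (block_op P A Q w - forward_op h w)"
    and u': "u' \<in> J (block_op P A Q w' - forward_op h w')"
  shows "- (L / 4) * (norm (fst (w - w' - (u - u'))))\<^sup>2
    \<le> (u - u') \<bullet> block_op P A Q (w - w' - (u - u'))"
proof -
  define D where "D x = gradient f x - gradient h x + \<sigma> *\<^sub>R (transpose A *v (A *v x - b))" for x
  have Df: "GDERIV f x :> gradient f x" and Dh: "GDERIV h x :> gradient h x" for x
    using f h(2) by (auto simp: cont_differentiable_def intro: GDERIV_gradient)
  have D: "GDERIV (\<lambda>x. f x - h x + \<sigma> / 2 * (norm (A *v x - b))\<^sup>2) x :> D x" for x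
    unfolding D_def by (intro GDERIV_add GDERIV_diff Df Dh GDERIV_least_squares)
  obtain x y x' y' x1 y1 x1' y1' where
    eqs: "w = (x, y)" "w' = (x', y')" "u = (x1, y1)" "u' = (x1', y1')"
    by (metis surj_pair)
  define d e s dy ey sy where "d = x - x'" and "e = x1 - x1'" and "s = d - e"
    and "dy = y - y'" and "ey = y1 - y1'" and "sy = dy - ey"
  note defs = d_def e_def s_def dy_def ey_def sy_def
  define v v' where "v = P *v x + transpose A *v y - gradient h x - P *v x1 - D x1"
    and "v' = P *v x' + transpose A *v y' - gradient h x' - P *v x1' - D x1'"
  have "block_op P A Q w - forward_op h w
      = (P *v x + transpose A *v y - gradient h x, A *v x + Q *v y)"
    by (simp add: eqs block_op_def forward_op_def)
  then have v: "v \<in> subdifferential g x1" and y1: "Q *v y1 = A *v x + Q *v y + b - 2 *\<^sub>R (A *v x1)"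
    using u unfolding J_def eqs v_def D_def by (simp_all only: mem_resolvent_iff)
  have "block_op P A Q w' - forward_op h w'
      = (P *v x' + transpose A *v y' - gradient h x', A *v x' + Q *v y')"
    by (simp add: eqs block_op_def forward_op_def)
  then have v': "v' \<in> subdifferential g x1'"
    and y1': "Q *v y1' = A *v x' + Q *v y' + b - 2 *\<^sub>R (A *v x1')"
    using u' unfolding J_def eqs v'_def D_def by (simp_all only: mem_resolvent_iff)
  note mv = matrix_vector_mult_diff_distrib matrix_vector_right_distrib
  have dual: "A *v s + Q *v sy = A *v e"
    using y1 y1' unfolding defs by (simp add: mv scaleR_2)
  have primal: "P *v s + transpose A *v dy = (v - v') + (D x1 - D x1') + (gradient h x - gradient h x')"
    unfolding defs v_def v'_def by (simp add: mv del: transpose_matrix_vector)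
  have "(u - u') \<bullet> block_op P A Q (w - w' - (u - u')) =
      e \<bullet> (P *v s + transpose A *v sy) + ey \<bullet> (A *v s + Q *v sy)"
    by (simp add: eqs block_op_def defs inner_prod_def)
  \<comment> \<open>By \<open>dual\<close> the second summand is
    \<open>ey \<bullet> (A *v e)\<close>. Since \<open>sy + ey = dy\<close>, it combines with the
    \<open>sy\<close> term into the left-hand side of \<open>primal\<close>.\<close>
  also have "\<dots> = e \<bullet> (P *v s + transpose A *v dy)"
    unfolding dual inner_add_right inner_transpose_mult
    by (simp add: sy_def inner_diff_right inner_commute)
  also have "\<dots> = e \<bullet> (v - v') + e \<bullet> (D x1 - D x1') + (x - x' - s) \<bullet> (gradient h x - gradient h x')"
    unfolding primal by (simp add: inner_add_right s_def d_def)
  \<comment> \<open>The first two terms are nonnegative by monotonicity. In the third, the gradients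
    of \<open>h\<close> are taken at the old points while the factor is the new difference
    \<open>e = x - x' - s\<close>; this mismatch costs \<open>L / 4 * |s|^2\<close>.\<close>
  also have "\<dots> \<ge> - (L / 4) * (norm s)\<^sup>2"
    using subdifferential_monotone[OF g v v'] convex_gradient_monotone[OF fh D, of x1 x1']
      convex_lipschitz_gradient_shift[OF h(1) Dh h(3), of s x x'] unfolding e_def by linarith
  finally show ?thesis
    by (simp add: eqs s_def d_def e_def)
qed

text \<open>In the seminorm of \<open>M\<close>, \<open>|d - (1 + \<gamma>) s|^2 \<le> |d|^2\<close>
  follows from \<open>(1 + \<gamma>) |s|^2 \<le> 2 <s, M d>\<close>. The hypothesis
  \<open>step\<close> gives \<open>(1 - c) |s|^2 \<le> <s, M d>\<close>, so
  \<open>1 + \<gamma> \<le> 2 (1 - c)\<close> suffices.\<close>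

lemma relaxed_map_nonexpansive:
  fixes M :: "'a::real_inner \<Rightarrow> 'a"
  assumes M: "pos_semidef M"
    and step: "\<And>w w'. - c * ((w - w' - (F w - F w')) \<bullet> M (w - w' - (F w - F w')))
      \<le> (F w - F w') \<bullet> M (w - w' - (F w - F w'))"
    and \<gamma>: "-1 < \<gamma>" "\<gamma> \<le> 1 - 2 * c"
  shows "(relaxed_map \<gamma> F w - relaxed_map \<gamma> F w') \<bullet> M (relaxed_map \<gamma> F w - relaxed_map \<gamma> F w')
    \<le> (w - w') \<bullet> M (w - w')"
proof -
  have sa: "self_adjoint M" and lin: "linear M"
    using M by (auto simp: pos_semidef_def self_adjoint_def)
  define d s where "d = w - w'" and "s = w - w' - (F w - F w')"
  have e: "F w - F w' = d - s"
    by (simp add: d_def s_def)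
  have diff: "relaxed_map \<gamma> F w - relaxed_map \<gamma> F w' = d - (1 + \<gamma>) *\<^sub>R s"
    by (simp add: relaxed_map_def d_def s_def algebra_simps)
  have ss: "0 \<le> s \<bullet> M s"
    using M by (simp add: pos_semidef_def)
  have "(1 - c) * (s \<bullet> M s) \<le> s \<bullet> M d"
    using step[of w w', folded s_def, unfolded e]
    by (simp add: inner_diff_left self_adjoint_inner[OF sa, of d s] algebra_simps)
  then have "2 * (1 + \<gamma>) * ((1 - c) * (s \<bullet> M s)) \<le> 2 * (1 + \<gamma>) * (s \<bullet> M d)"
    using \<gamma>(1) by (intro mult_left_mono) auto
  moreover have "(1 + \<gamma>) * ((1 + \<gamma>) * (s \<bullet> M s)) \<le> (1 + \<gamma>) * ((2 * (1 - c)) * (s \<bullet> M s))"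
    using \<gamma> ss by (intro mult_left_mono mult_right_mono) auto
  ultimately show ?thesis
    unfolding diff d_def[symmetric] self_adjoint_diff_square[OF sa, of d]
    by (simp add: linear_cmul[OF lin] ring_distribs)
qed

section \<open>Restarted convergence\<close>

text \<open>The residual of the relaxed map is \<open>1 + \<gamma>\<close> times that of
  \<open>F\<close>, and the bound for each fixed point passes to the infimum over
  \<open>W\<close>.\<close>

lemma halpern_residual_dist_bound:
  fixes M F :: "'a::real_inner \<Rightarrow> 'a"
  assumes M: "pos_semidef M" and \<gamma>: "-1 < \<gamma>"
    and nonexp: "\<And>u v. (relaxed_map \<gamma> F u - relaxed_map \<gamma> F v)
        \<bullet> M (relaxed_map \<gamma> F u - relaxed_map \<gamma> F v) \<le> (u - v) \<bullet> M (u - v)"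
    and rec: "\<And>k. x (Suc k) = (1 / (real k + 2)) *\<^sub>R x 0
        + ((real k + 1) / (real k + 2)) *\<^sub>R relaxed_map \<gamma> F (x k)"
    and W: "W \<noteq> {}" "\<And>z. z \<in> W \<Longrightarrow> F z = z"
  shows "op_norm M (x k - F (x k)) \<le> 2 / ((1 + \<gamma>) * (real k + 1)) * op_dist M (x 0) W"
proof -
  have "linear M"
    using M by (simp add: pos_semidef_def self_adjoint_def)
  then have scale: "op_norm M (c *\<^sub>R u) = \<bar>c\<bar> * op_norm M u" for c u
    by (simp add: op_norm_def linear_cmul real_sqrt_mult flip: mult.assoc power2_eq_square)
  have residual: "op_norm M (u - relaxed_map \<gamma> F u) = (1 + \<gamma>) * op_norm M (u - F u)" for u
  proof -
    have "u - relaxed_map \<gamma> F u = (1 + \<gamma>) *\<^sub>R (u - F u)"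
      by (simp add: relaxed_map_def algebra_simps)
    then show ?thesis
      using \<gamma> by (simp add: scale)
  qed
  have "(real k + 1) * ((1 + \<gamma>) * op_norm M (x k - F (x k))) / 2 \<le> op_norm M (x 0 - z)" if "z \<in> W" for z
  proof -
    have "relaxed_map \<gamma> F z = z"
      using W(2)[OF that] by (simp add: relaxed_map_def algebra_simps)
    from halpern_residual_bound[OF M nonexp rec this, of k] show ?thesis
      unfolding residual by simp
  qed
  then have "(real k + 1) * ((1 + \<gamma>) * op_norm M (x k - F (x k))) / 2 \<le> op_dist M (x 0) W"
    unfolding op_dist_def by (intro cINF_greatest W(1))
  then show ?thesis
    using \<gamma> by (simp add: pos_le_divide_eq mult_ac)
qed

text \<open>Put \<open>a = r (w n 0) / op_dist M (w n 0) W\<close>. The epoch rate bounds the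
  residual after \<open>k\<close> steps by \<open>2 / (a (1 + \<gamma>) (k + 1))\<close> times the
  initial one, and this factor is at most \<beta> once \<open>k + 1\<close> reaches
  \<open>2 / (a \<beta> (1 + \<gamma>))\<close>.\<close>

lemma restarted_halpern_linear_convergence:
  fixes M F :: "'a::real_inner \<Rightarrow> 'a"
  assumes M: "pos_def M" and \<gamma>: "-1 < \<gamma>" and \<beta>: "0 < \<beta>" "\<beta> < 1" and \<alpha>: "0 < \<alpha>"
    and nonexp: "\<And>u v. (relaxed_map \<gamma> F u - relaxed_map \<gamma> F v)
        \<bullet> M (relaxed_map \<gamma> F u - relaxed_map \<gamma> F v) \<le> (u - v) \<bullet> M (u - v)"
    and W: "W \<noteq> {}" "\<And>z. F z = z \<longleftrightarrow> z \<in> W"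
    and r: "r = (\<lambda>u. op_norm M (u - F u))"
    and scheme: "restarted_halpern (relaxed_map \<gamma> F) r \<beta> K\<^sub>0 w K"
    and iterates: "\<forall>n. \<forall>k\<le>K n. w n k \<in> \<K>"
    and sharpness: "\<forall>u\<in>\<K>. \<alpha> * op_dist M u W \<le> r u"
  shows
    "(\<forall>n\<ge>1.
        (\<exists>k. restart_cond r \<beta> (w n) k) \<and>
        (w n 0 \<notin> W \<longrightarrow>
          (let \<alpha>\<^sub>n = r (w n 0) / op_dist M (w n 0) W in
            \<alpha> \<le> \<alpha>\<^sub>n \<and>
            int (K n) \<le> \<lceil>2 / (\<alpha>\<^sub>n * \<beta> * (1 + \<gamma>))\<rceil> \<and>
            \<lceil>2 / (\<alpha>\<^sub>n * \<beta> * (1 + \<gamma>))\<rceil> \<le> \<lceil>2 / (\<alpha> * \<beta> * (1 + \<gamma>))\<rceil>)) \<and>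
        (w n 0 \<in> W \<longrightarrow> r (w n 0) = 0 \<and> restart_cond r \<beta> (w n) 0)) \<and>
     (\<forall>n\<ge>1. r (w n 0) \<le> \<beta> ^ (n - 1) * r (w 1 0)) \<and>
     (\<forall>n\<ge>1. op_dist M (w n 0) W \<le>
        2 / (\<alpha> * (1 + \<gamma>) * (real K\<^sub>0 + 1)) * \<beta> ^ (n - 1) * op_dist M (w 0 0) W)"
proof -
  have psd: "pos_semidef M"
    using M by (rule pos_def_imp_pos_semidef)
  have inner: "w n (Suc k) = (1 / (real k + 2)) *\<^sub>R w n 0
        + ((real k + 1) / (real k + 2)) *\<^sub>R relaxed_map \<gamma> F (w n k)"
    and restart: "w (Suc n) 0 = w n (K n)" and K0: "K 0 = K\<^sub>0"
    and K: "1 \<le> n \<Longrightarrow> K n = (LEAST k. restart_cond r \<beta> (w n) k)" for n k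
    using scheme unfolding restarted_halpern_def by blast+
  have rate: "r (w n k) \<le> 2 / ((1 + \<gamma>) * (real k + 1)) * op_dist M (w n 0) W" for n k
    unfolding r using psd \<gamma> nonexp inner W by (intro halpern_residual_dist_bound) auto
  have r_zero: "r u = 0 \<longleftrightarrow> u \<in> W" for u
  proof
    assume "r u = 0"
    then have "\<not> 0 < (u - F u) \<bullet> M (u - F u)"
      by (simp add: r op_norm_def)
    then have "u - F u = 0"
      using M unfolding pos_def_def by blast
    then show "u \<in> W"
      using W(2)[of u] by simp
  next
    assume "u \<in> W"
    then have "F u = u"
      using W(2) by simp
    then show "r u = 0"
      by (simp add: r op_norm_def)
  qed
  have r_nonneg: "0 \<le> r u" for u
    using psd by (simp add: r op_norm_def pos_semidef_def)
  have sharp: "\<alpha> * op_dist M (w n 0) W \<le> r (w n 0)" for n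
    using sharpness iterates by blast
  have outside: "\<alpha> \<le> r (w n 0) / op_dist M (w n 0) W"
      "restart_cond r \<beta> (w n) (nat \<lceil>2 / (r (w n 0) / op_dist M (w n 0) W * \<beta> * (1 + \<gamma>))\<rceil>)"
    if "w n 0 \<notin> W" for n
  proof -
    define \<delta> where "\<delta> = op_dist M (w n 0) W"
    have "0 < r (w n 0)"
      using r_nonneg[of "w n 0"] r_zero[of "w n 0"] that by linarith
    moreover have "r (w n 0) \<le> 2 / (1 + \<gamma>) * \<delta>"
      using rate[of n 0] by (simp add: \<delta>_def)
    ultimately have "0 < 2 / (1 + \<gamma>) * \<delta>"
      by linarith
    then have \<delta>: "0 < \<delta>"
      using \<gamma> by (simp add: zero_less_mult_iff zero_less_divide_iff)
    define a where "a = r (w n 0) / \<delta>"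
    have r_eq: "r (w n 0) = a * \<delta>"
      using \<delta> by (simp add: a_def)
    show "\<alpha> \<le> r (w n 0) / op_dist M (w n 0) W"
      using sharp[of n] \<delta> by (simp add: \<delta>_def pos_le_divide_eq)
    then have a: "0 < a"
      using \<alpha> by (simp add: a_def \<delta>_def)
    define k where "k = nat \<lceil>2 / (a * \<beta> * (1 + \<gamma>))\<rceil>"
    have "2 / (a * \<beta> * (1 + \<gamma>)) \<le> real k"
      unfolding k_def by (rule real_nat_ceiling_ge)
    then have "2 / (a * \<beta> * (1 + \<gamma>)) \<le> real k + 1"
      by linarith
    then have "2 \<le> (real k + 1) * (a * \<beta> * (1 + \<gamma>))"
      using a \<beta> \<gamma> by (simp add: pos_divide_le_eq)
    then have "2 / ((1 + \<gamma>) * (real k + 1)) \<le> \<beta> * a"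
      using \<gamma> by (simp add: pos_divide_le_eq mult_ac)
    then have "2 / ((1 + \<gamma>) * (real k + 1)) * \<delta> \<le> \<beta> * a * \<delta>"
      using \<delta> by (intro mult_right_mono) auto
    then have "r (w n k) \<le> \<beta> * r (w n 0)"
      using rate[of n k] unfolding r_eq \<delta>_def[symmetric] by (simp add: mult.assoc)
    then show "restart_cond r \<beta> (w n) (nat \<lceil>2 / (r (w n 0) / op_dist M (w n 0) W * \<beta> * (1 + \<gamma>))\<rceil>)"
      by (simp add: restart_cond_def k_def a_def \<delta>_def)
  qed
  have inside: "restart_cond r \<beta> (w n) 0" if "w n 0 \<in> W" for n
    using that by (simp add: restart_cond_def r_zero[THEN iffD2])
  \<comment> \<open>Once some index passes the test, the \<open>LEAST\<close> in the scheme is a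
    genuine stopping index and passes the test itself.\<close>
  have terminates: "\<exists>k. restart_cond r \<beta> (w n) k" for n
    using outside(2) inside by blast
  have step: "r (w (Suc n) 0) \<le> \<beta> * r (w n 0)" if "1 \<le> n" for n
    using LeastI_ex[OF terminates, of n] unfolding restart K[OF that] restart_cond_def .
  have linear: "r (w n 0) \<le> \<beta> ^ (n - 1) * r (w 1 0)" if "1 \<le> n" for n
    using that
  proof (induction n rule: nat_induct_at_least)
    case (Suc n)
    have "r (w (Suc n) 0) \<le> \<beta> * (\<beta> ^ (n - 1) * r (w 1 0))"
      using step[OF Suc.hyps] mult_left_mono[OF Suc.IH, of \<beta>] \<beta> by linarith
    then show ?case
      using Suc.hyps by (cases n) (auto simp: mult_ac)
  qed simp
  \<comment> \<open>Sharpness bounds the distance by the residual, \<open>linear\<close> leads back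
    to the start of epoch 1, and the rate of epoch 0, run for \<open>K\<^sub>0\<close> steps, bounds
    the residual there.\<close>
  have dist: "op_dist M (w n 0) W \<le>
      2 / (\<alpha> * (1 + \<gamma>) * (real K\<^sub>0 + 1)) * \<beta> ^ (n - 1) * op_dist M (w 0 0) W" if "1 \<le> n" for n
  proof -
    have "r (w 1 0) \<le> 2 / ((1 + \<gamma>) * (real K\<^sub>0 + 1)) * op_dist M (w 0 0) W"
      using rate[of 0 "K 0"] restart[of 0] K0 by simp
    then have "\<beta> ^ (n - 1) * r (w 1 0)
        \<le> \<beta> ^ (n - 1) * (2 / ((1 + \<gamma>) * (real K\<^sub>0 + 1)) * op_dist M (w 0 0) W)"
      using \<beta> by (intro mult_left_mono) auto
    then have "op_dist M (w n 0) W * \<alpha>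
        \<le> \<beta> ^ (n - 1) * (2 / ((1 + \<gamma>) * (real K\<^sub>0 + 1)) * op_dist M (w 0 0) W)"
      using sharp[of n] linear[OF that] by (simp only: mult.commute[of _ \<alpha>])
    then have "op_dist M (w n 0) W
        \<le> \<beta> ^ (n - 1) * (2 / ((1 + \<gamma>) * (real K\<^sub>0 + 1)) * op_dist M (w 0 0) W) / \<alpha>"
      by (rule mult_imp_le_div_pos[OF \<alpha>])
    then show ?thesis
      by (simp add: mult_ac)
  qed
  have epoch_length: "let \<alpha>\<^sub>n = r (w n 0) / op_dist M (w n 0) W in
            \<alpha> \<le> \<alpha>\<^sub>n \<and>
            int (K n) \<le> \<lceil>2 / (\<alpha>\<^sub>n * \<beta> * (1 + \<gamma>))\<rceil> \<and>
            \<lceil>2 / (\<alpha>\<^sub>n * \<beta> * (1 + \<gamma>))\<rceil> \<le> \<lceil>2 / (\<alpha> * \<beta> * (1 + \<gamma>))\<rceil>"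
    if "1 \<le> n" "w n 0 \<notin> W" for n
  proof -
    define a where "a = r (w n 0) / op_dist M (w n 0) W"
    have a: "\<alpha> \<le> a"
      using outside(1)[OF that(2)] by (simp add: a_def)
    have "K n \<le> nat \<lceil>2 / (a * \<beta> * (1 + \<gamma>))\<rceil>"
      unfolding K[OF that(1)] using outside(2)[OF that(2)] by (intro Least_le) (simp add: a_def)
    moreover have "0 \<le> 2 / (a * \<beta> * (1 + \<gamma>))"
      using a \<alpha> \<beta> \<gamma> by simp
    ultimately have "int (K n) \<le> \<lceil>2 / (a * \<beta> * (1 + \<gamma>))\<rceil>"
      by (simp add: le_nat_iff)
    moreover have "2 / (a * \<beta> * (1 + \<gamma>)) \<le> 2 / (\<alpha> * \<beta> * (1 + \<gamma>))"
      using a \<alpha> \<beta> \<gamma> by (intro divide_left_mono mult_right_mono mult_pos_pos) auto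
    ultimately show ?thesis
      using a unfolding Let_def a_def[symmetric] by (simp add: ceiling_mono)
  qed
  show ?thesis
    using terminates epoch_length r_zero[THEN iffD2] inside linear dist by blast
qed

section \<open>The exact and the linearized map as instances\<close>

text \<open>The common core of both cases. What remains for each map is the unique solvability of
  the primal inclusion and a constant \<open>c\<close> for which the form of \<open>M\<close>
  absorbs the loss \<open>L / 4\<close>.\<close>

lemma primal_dual_map_properties:
  fixes A :: "real^'n^'m" and P Q and f h :: "real^'n \<Rightarrow> real" and g b \<sigma>
  defines "M \<equiv> block_op P A Q" and "T \<equiv> kkt_op f g A b \<sigma>"
  defines "F \<equiv> linearized_map M T (forward_op h)"
  assumes g: "proper_closed_convex g" and f: "cont_differentiable f"
    and h: "convex_on UNIV h" "cont_differentiable h" "L-lipschitz_on UNIV (gradient h)"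
    and fh: "convex_on UNIV (\<lambda>x. f x - h x + \<sigma> / 2 * (norm (A *v x - b))\<^sup>2)"
    and Q: "pos_def ((*v) Q)" and M: "pos_semidef M"
    and primal: "\<And>p. \<exists>!x. p - P *v x - (gradient f x - gradient h x
        + \<sigma> *\<^sub>R (transpose A *v (A *v x - b))) \<in> subdifferential g x"
    and c: "\<And>u. L / 4 * (norm (fst u))\<^sup>2 \<le> c * (u \<bullet> M u)"
    and \<gamma>: "-1 < \<gamma>" "\<gamma> \<le> 1 - 2 * c"
  shows "F w = w \<longleftrightarrow> w \<in> op_inv T 0"
    and "(relaxed_map \<gamma> F w - relaxed_map \<gamma> F w') \<bullet> M (relaxed_map \<gamma> F w - relaxed_map \<gamma> F w')
      \<le> (w - w') \<bullet> M (w - w')"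
proof -
  have single: "\<exists>!u. u \<in> op_inv (map_plus M (map_plus (\<lambda>u. - forward_op h u) T)) z" for z
    unfolding M_def T_def using resolvent_single_valued[OF Q primal] by (cases z) simp
  show "F w = w \<longleftrightarrow> w \<in> op_inv T 0"
    unfolding F_def by (rule linearized_map_fixed_iff[OF single])
  have mem: "F w \<in> op_inv (map_plus M (map_plus (\<lambda>u. - forward_op h u) T)) (M w - forward_op h w)" for w
    unfolding F_def by (rule linearized_map_mem[OF single])
  have "- c * ((w - w' - (F w - F w')) \<bullet> M (w - w' - (F w - F w')))
      \<le> (F w - F w') \<bullet> M (w - w' - (F w - F w'))" for w w'
    using resolvent_step_bound[OF g f h fh mem[of w, unfolded M_def T_def] mem[of w', unfolded M_def T_def]]
      c[of "w - w' - (F w - F w')"] unfolding M_def[symmetric] T_def[symmetric] by simp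
  then show "(relaxed_map \<gamma> F w - relaxed_map \<gamma> F w') \<bullet> M (relaxed_map \<gamma> F w - relaxed_map \<gamma> F w')
      \<le> (w - w') \<bullet> M (w - w')"
    using relaxed_map_nonexpansive[OF M _ \<gamma>] by blast
qed

lemma mem_map_plus_iff: "z \<in> map_plus M T u \<longleftrightarrow> z - M u \<in> T u"
proof
  assume "z - M u \<in> T u"
  moreover have "z = M u + (z - M u)" by simp
  ultimately show "z \<in> map_plus M T u"
    unfolding map_plus_def by blast
qed (auto simp: map_plus_def)

text \<open>Shifting the argument of the inverse by
  \<open>\<sigma> *\<^sub>R (transpose A *v b)\<close> absorbs \<open>b\<close>; the sum rule then
  identifies its value with the primal solution. The zero gradient keeps the shape of the general
  lemma at \<open>h = 0\<close>.\<close>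

lemma exact_primal_equation:
  fixes A :: "real^'n^'m"
  assumes g: "proper_closed_convex g" and f: "convex_on UNIV f" "cont_differentiable f"
    and ex: "exact_assms f g A \<sigma> P Q"
  shows "\<exists>!x. p - P *v x - (gradient f x - gradient (\<lambda>_. 0) x
      + \<sigma> *\<^sub>R (transpose A *v (A *v x - b))) \<in> subdifferential g x"
proof -
  obtain R where R: "\<And>z. op_inv (map_plus (\<lambda>x. P *v x + \<sigma> *\<^sub>R (transpose A *v (A *v x)))
      (subdifferential (\<lambda>x. ereal (f x) + g x))) z = {R z}"
    using ex unfolding exact_assms_def has_lipschitz_inverse_def by blast
  have "x \<in> op_inv (map_plus (\<lambda>x. P *v x + \<sigma> *\<^sub>R (transpose A *v (A *v x)))
        (subdifferential (\<lambda>x. ereal (f x) + g x))) (p + \<sigma> *\<^sub>R (transpose A *v b)) \<longleftrightarrow>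
      p - P *v x - (gradient f x - gradient (\<lambda>_. 0) x
        + \<sigma> *\<^sub>R (transpose A *v (A *v x - b))) \<in> subdifferential g x" (is "?L x \<longleftrightarrow> ?R x") for x
  proof -
    define v where "v = p + \<sigma> *\<^sub>R (transpose A *v b) - (P *v x + \<sigma> *\<^sub>R (transpose A *v (A *v x)))"
    have "?L x \<longleftrightarrow> v \<in> subdifferential (\<lambda>x. ereal (f x) + g x) x"
      by (simp only: op_inv_def mem_Collect_eq mem_map_plus_iff v_def)
    also have "\<dots> \<longleftrightarrow> v - gradient f x \<in> subdifferential g x"
      using f by (intro subdifferential_smooth_plus_convex[OF g] GDERIV_gradient)
        (auto simp: cont_differentiable_def)
    also have "v - gradient f x = p - P *v x - (gradient f x - gradient (\<lambda>_. 0) x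
        + \<sigma> *\<^sub>R (transpose A *v (A *v x - b)))"
      by (simp add: v_def gradient_zero matrix_vector_mult_diff_distrib scaleR_diff_right
          del: transpose_matrix_vector)
    finally show ?thesis .
  qed
  then have "?R x \<longleftrightarrow> x = R (p + \<sigma> *\<^sub>R (transpose A *v b))" for x
    using R by blast
  then show ?thesis by simp
qed

lemma convex_on_least_squares:
  fixes A :: "real^'n^'m"
  assumes "0 \<le> \<sigma>"
  shows "convex_on UNIV (\<lambda>x. \<sigma> / 2 * (norm (A *v x - b))\<^sup>2)"
proof -
  have "convex_on UNIV (\<lambda>x. (norm (A *v x - b))\<^sup>2)"
  proof (rule convex_onI)
    fix t :: real and x y :: "real^'n"
    assume t: "0 < t" "t < 1"
    define p q where "p = A *v x - b" and "q = A *v y - b"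
    have "A *v ((1 - t) *\<^sub>R x + t *\<^sub>R y) - b = (1 - t) *\<^sub>R p + t *\<^sub>R q"
      by (simp add: p_def q_def matrix_vector_right_distrib matrix_vector_mult_scaleR algebra_simps)
    moreover have "(1 - t) * (norm p)\<^sup>2 + t * (norm q)\<^sup>2 - (norm ((1 - t) *\<^sub>R p + t *\<^sub>R q))\<^sup>2
        = t * (1 - t) * (norm (p - q))\<^sup>2"
      unfolding power2_norm_eq_inner
      by (simp add: inner_add_left inner_add_right inner_diff_left inner_diff_right inner_commute algebra_simps)
    moreover have "0 \<le> t * (1 - t) * (norm (p - q))\<^sup>2"
      using t by simp
    ultimately show "(norm (A *v ((1 - t) *\<^sub>R x + t *\<^sub>R y) - b))\<^sup>2
        \<le> (1 - t) * (norm (A *v x - b))\<^sup>2 + t * (norm (A *v y - b))\<^sup>2"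
      by (simp add: p_def q_def)
  qed simp
  then show ?thesis
    using assms by (intro convex_on_cmul) auto
qed

text \<open>For \<open>h = 0\<close> both \<open>L\<close> and \<open>c\<close> are taken to be 0,
  so \<gamma> may go up to 1.\<close>

lemma exact_map_properties:
  fixes A :: "real^'n^'m" and P Q and f :: "real^'n \<Rightarrow> real" and g b \<sigma>
  defines "M \<equiv> block_op P A Q" and "T \<equiv> kkt_op f g A b \<sigma>"
  defines "F \<equiv> exact_map M T"
  assumes \<sigma>: "0 \<le> \<sigma>" and f: "convex_on UNIV f" "cont_differentiable f"
    and g: "proper_closed_convex g" and ex: "exact_assms f g A \<sigma> P Q"
    and \<gamma>: "-1 < \<gamma>" "\<gamma> \<le> 1"
  shows "F w = w \<longleftrightarrow> w \<in> op_inv T 0"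
    and "(relaxed_map \<gamma> F w - relaxed_map \<gamma> F w') \<bullet> M (relaxed_map \<gamma> F w - relaxed_map \<gamma> F w')
      \<le> (w - w') \<bullet> M (w - w')"
proof -
  have zero: "convex_on UNIV (\<lambda>_::real^'n. 0::real)" "cont_differentiable (\<lambda>_::real^'n. 0)"
      "0-lipschitz_on UNIV (gradient (\<lambda>_::real^'n. 0))"
    by (auto simp: convex_on_const cont_differentiable_def gradient_zero lipschitz_on_def
        cong: continuous_on_cong)
  have fh: "convex_on UNIV (\<lambda>x. f x - 0 + \<sigma> / 2 * (norm (A *v x - b))\<^sup>2)"
    using convex_on_add[OF f(1) convex_on_least_squares[OF \<sigma>]] by simp
  note props = primal_dual_map_properties[OF g f(2) zero fh, of Q P 0 \<gamma>,
      folded exact_map_eq_linearized_map, folded M_def T_def, folded F_def]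
  have pd: "pos_def ((*v) Q)" "pos_semidef M"
    using ex by (auto simp: exact_assms_def M_def)
  show "F w = w \<longleftrightarrow> w \<in> op_inv T 0"
    by (rule props(1)[OF pd exact_primal_equation[OF g f ex]]) (use \<gamma> in auto)
  show "(relaxed_map \<gamma> F w - relaxed_map \<gamma> F w') \<bullet> M (relaxed_map \<gamma> F w - relaxed_map \<gamma> F w')
      \<le> (w - w') \<bullet> M (w - w')"
    by (rule props(2)[OF pd exact_primal_equation[OF g f ex]]) (use \<gamma> in auto)
qed

text \<open>The Schur complement bound gives \<open>c = L / (4 \<mu>)\<close>, so that
  \<open>1 - 2 * c\<close> is the stated bound on \<gamma>.\<close>

lemma linearized_map_properties:
  fixes A :: "real^'n^'m" and P Q and f h :: "real^'n \<Rightarrow> real" and g b \<sigma>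
  defines "M \<equiv> block_op P A Q" and "T \<equiv> kkt_op f g A b \<sigma>"
  defines "F \<equiv> linearized_map M T (forward_op h)"
  assumes f: "cont_differentiable f" and g: "proper_closed_convex g"
    and lin: "linearized_assms f A b \<sigma> P Q h L"
    and P: "self_adjoint ((*v) P)" and M: "pos_def M"
    and \<gamma>: "-1 < \<gamma>" "\<gamma> < 1 - L / (2 * lambda_min (schur_compl P A Q))"
  shows "F w = w \<longleftrightarrow> w \<in> op_inv T 0"
    and "(relaxed_map \<gamma> F w - relaxed_map \<gamma> F w') \<bullet> M (relaxed_map \<gamma> F w - relaxed_map \<gamma> F w')
      \<le> (w - w') \<bullet> M (w - w')"
proof -
  define \<mu> where "\<mu> = lambda_min (schur_compl P A Q)"
  have h: "convex_on UNIV h" "cont_differentiable h" "L-lipschitz_on UNIV (gradient h)"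
    and fh: "convex_on UNIV (\<lambda>x. f x - h x + \<sigma> / 2 * (norm (A *v x - b))\<^sup>2)"
    and Q: "pos_def ((*v) Q)" and schur: "self_adjoint ((*v) (schur_compl P A Q))"
    and \<mu>: "L / 2 < \<mu>"
    using lin unfolding linearized_assms_def \<mu>_def pos_def_def by auto
  have L: "0 \<le> L"
    using h(3) by (rule lipschitz_on_nonneg)
  have psd: "pos_semidef M"
    using M by (rule pos_def_imp_pos_semidef)
  \<comment> \<open>Positive definiteness of \<open>M\<close> is tested on the vectors
    \<open>(x, 0)\<close>.\<close>
  have P_pos: "pos_def ((*v) P)"
    unfolding pos_def_def
  proof (intro conjI allI impI P)
    fix x :: "real^'n" assume "x \<noteq> 0"
    then have "0 < (x, 0) \<bullet> M (x, 0)"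
      using M unfolding pos_def_def by (metis prod.inject zero_prod_def)
    then show "0 < x \<bullet> (P *v x)"
      by (simp add: M_def block_op_def inner_prod_def)
  qed
  have grad: "GDERIV (\<lambda>x. f x - h x + \<sigma> / 2 * (norm (A *v x - b))\<^sup>2) x
      :> gradient f x - gradient h x + \<sigma> *\<^sub>R (transpose A *v (A *v x - b))" for x
    using f h(2)
    by (intro GDERIV_add GDERIV_diff GDERIV_least_squares GDERIV_gradient) (auto simp: cont_differentiable_def)
  have primal: "\<exists>!x. p - P *v x - (gradient f x - gradient h x
        + \<sigma> *\<^sub>R (transpose A *v (A *v x - b))) \<in> subdifferential g x" for p
    by (rule convex_smooth_subgradient_equation[OF g fh grad P_pos])
  have c: "L / 4 * (norm (fst u))\<^sup>2 \<le> L / (4 * \<mu>) * (u \<bullet> M u)" for u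
  proof -
    obtain x y where u: "u = (x, y)" by (cases u)
    have "\<mu> * (norm x)\<^sup>2 \<le> u \<bullet> M u"
      using lambda_min_le[OF schur, of x] schur_compl_le_block_op[OF Q, of x P A y]
      unfolding \<mu>_def M_def u by linarith
    then have "L / (4 * \<mu>) * (\<mu> * (norm x)\<^sup>2) \<le> L / (4 * \<mu>) * (u \<bullet> M u)"
      using L \<mu> by (intro mult_left_mono) auto
    then show ?thesis
      using L \<mu> by (simp add: u)
  qed
  have \<gamma>': "\<gamma> \<le> 1 - 2 * (L / (4 * \<mu>))"
    using \<gamma>(2) by (simp add: \<mu>_def)
  note props = primal_dual_map_properties[OF g f h fh Q, of P, folded M_def T_def, folded F_def,
      OF psd primal c \<gamma>(1) \<gamma>']
  show "F w = w \<longleftrightarrow> w \<in> op_inv T 0"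
    by (rule props(1))
  show "(relaxed_map \<gamma> F w - relaxed_map \<gamma> F w') \<bullet> M (relaxed_map \<gamma> F w - relaxed_map \<gamma> F w')
      \<le> (w - w') \<bullet> M (w - w')"
    by (rule props(2))
qed

theorem theorem7:
  fixes A :: "real^'n^'m" and b :: "real^'m" and \<sigma> :: real
    and f :: "real^'n \<Rightarrow> real" and g :: "real^'n \<Rightarrow> ereal"
    and P :: "real^'n^'n" and Q :: "real^'m^'m"
    and h :: "real^'n \<Rightarrow> real" and L\<^sub>h :: real
    and M :: "(real^'n) \<times> (real^'m) \<Rightarrow> (real^'n) \<times> (real^'m)"
    and T :: "(real^'n) \<times> (real^'m) \<Rightarrow> ((real^'n) \<times> (real^'m)) set"
    and W :: "((real^'n) \<times> (real^'m)) set"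
    and F :: "(real^'n) \<times> (real^'m) \<Rightarrow> (real^'n) \<times> (real^'m)"
    and r :: "(real^'n) \<times> (real^'m) \<Rightarrow> real"
    and \<gamma> \<beta> \<alpha> :: real and K\<^sub>0 :: nat
    and w :: "nat \<Rightarrow> nat \<Rightarrow> (real^'n) \<times> (real^'m)" and K :: "nat \<Rightarrow> nat"
    and \<K> :: "((real^'n) \<times> (real^'m)) set"
  assumes "\<sigma> \<ge> 0"
    and "convex_on UNIV f" and "cont_differentiable f"
    and "\<exists>L. L-lipschitz_on UNIV (gradient f)"
    and "proper_closed_convex g"
    and "pos_semidef ((*v) P)" and "pos_semidef ((*v) Q)"
    and M: "M = block_op P A Q"
    and T: "T = kkt_op f g A b \<sigma>"
    and W: "W = op_inv T 0" and "W \<noteq> {}"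
    and F: "(F = exact_map M T \<and> exact_assms f g A \<sigma> P Q \<and> \<gamma> \<in> {-1<..1}) \<or>
       (F = linearized_map M T (forward_op h) \<and> linearized_assms f A b \<sigma> P Q h L\<^sub>h \<and>
        \<gamma> \<in> {-1<..<1 - L\<^sub>h / (2 * lambda_min (schur_compl P A Q))})"
    and "\<beta> \<in> {0<..<1}" and "\<alpha> > 0"
    and r: "r = (\<lambda>u. op_norm M (u - F u))"
    and scheme: "restarted_halpern (relaxed_map \<gamma> F) r \<beta> K\<^sub>0 w K"
    and "pos_def M"
    and iterates: "\<forall>n. \<forall>k\<le>K n. w n k \<in> \<K>"
    and sharpness: "\<forall>u\<in>\<K>. \<alpha> * op_dist M u W \<le> r u"
  shows
    "(\<forall>n\<ge>1.
        (\<exists>k. restart_cond r \<beta> (w n) k) \<and>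
        (w n 0 \<notin> W \<longrightarrow>
          (let \<alpha>\<^sub>n = r (w n 0) / op_dist M (w n 0) W in
            \<alpha> \<le> \<alpha>\<^sub>n \<and>
            int (K n) \<le> \<lceil>2 / (\<alpha>\<^sub>n * \<beta> * (1 + \<gamma>))\<rceil> \<and>
            \<lceil>2 / (\<alpha>\<^sub>n * \<beta> * (1 + \<gamma>))\<rceil> \<le> \<lceil>2 / (\<alpha> * \<beta> * (1 + \<gamma>))\<rceil>)) \<and>
        (w n 0 \<in> W \<longrightarrow> r (w n 0) = 0 \<and> restart_cond r \<beta> (w n) 0)) \<and>
     (\<forall>n\<ge>1. r (w n 0) \<le> \<beta> ^ (n - 1) * r (w 1 0)) \<and>
     (\<forall>n\<ge>1. op_dist M (w n 0) W \<le>
        2 / (\<alpha> * (1 + \<gamma>) * (real K\<^sub>0 + 1)) * \<beta> ^ (n - 1) * op_dist M (w 0 0) W)"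
proof (rule restarted_halpern_linear_convergence[where M = M and F = F])
  have P: "self_adjoint ((*v) P)"
    using \<open>pos_semidef ((*v) P)\<close> by (simp add: pos_semidef_def)
  note exact = exact_map_properties[OF \<open>\<sigma> \<ge> 0\<close> \<open>convex_on UNIV f\<close> \<open>cont_differentiable f\<close>
      \<open>proper_closed_convex g\<close>, of A P Q \<gamma> b, folded M T]
  note linearized = linearized_map_properties[OF \<open>cont_differentiable f\<close> \<open>proper_closed_convex g\<close>
      _ P, of A b \<sigma> Q h L\<^sub>h \<gamma>, folded M T, OF _ \<open>pos_def M\<close>]
  \<comment> \<open>Each case of \<open>F\<close> enters the convergence argument only through its
    fixed points, its nonexpansiveness and the lower bound on \<gamma>.\<close>
  show "F u = u \<longleftrightarrow> u \<in> W" for u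
    using F unfolding W by (elim disjE conjE) (simp_all add: exact(1) linearized(1))
  show "(relaxed_map \<gamma> F u - relaxed_map \<gamma> F v) \<bullet> M (relaxed_map \<gamma> F u - relaxed_map \<gamma> F v)
      \<le> (u - v) \<bullet> M (u - v)" for u v
    using F by (elim disjE conjE) (simp_all add: exact(2) linearized(2))
  show "-1 < \<gamma>"
    using F by auto
qed (use assms in auto)

end
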